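(* Let $\beta>1$ and $0<\zeta/\alpha<2$. For an integer $k\ge 0$ let $N_k$ denote the number of vertices of degree $k$ in $\mathcal{G}(N;\zeta,\alpha,\beta)$. Then for every fixed integer $k\ge0$, $$\frac{N_k}{N}\xrightarrow{p}\Pr[\mathsf{MP}(F)=k]\quad\text{as }N\to\infty,$$ where $\mathsf{MP}(F)$ is a mixed Poisson random variable with mixing distribution $F(t)=1-(K/t)^{2\alpha/\zeta}$ for $t\ge K$ and $F(t)=0$ for $t<K$, with $K=\frac{4\alpha}{2\alpha-\zeta}\cdot\frac{1}{\beta}\cdot\frac{1}{\sin(\pi/\beta)}$.
   Context: Model $\mathcal{G}(N;\zeta,\alpha,\beta)$: fix $0<\zeta<2$, $\alpha>0$, $\beta>0$. For a positive integer $N$ let $R$ be defined by $N=e^{\zeta R/2}$. Work in the native representation of the hyperbolic plane of curvature $-\zeta^2$: points of $\mathbb{R}^2$ in polar coordinates $(r,\theta)$, where $r$ is the hyperbolic distance from the origin, and the hyperbolic distance $d(u,v)$ between $u=(r_u,\theta_u)$ and $v=(r_v,\theta_v)$ is given by $\cosh(\zeta d(u,v))=\cosh(\zeta r_u)\cosh(\zeta r_v)-\sinh(\zeta r_u)\sinh(\zeta r_v)\cos(\theta_{u,v})$, with $\theta_{u,v}\in[0,\pi]$ the relative angle. The vertex set consists of $N$ independent random points in the disc $\mathcal{D}_R$ of radius $R$ about the origin, each with angle uniform on $(0,2\pi]$ and, independently, radius with density $\rho(r)=\alpha\frac{\sinh(\alpha r)}{\cosh(\alpha R)-1}$ on $[0,R]$.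 Given the positions, each pair of distinct vertices $u,v$ is joined independently with probability $p_{u,v}=\frac{1}{\exp\left(\beta\frac{\zeta}{2}(d(u,v)-R)\right)+1}$. A mixed Poisson variable satisfies $\Pr[\mathsf{MP}(F)=k]=\int e^{-t}\frac{t^k}{k!}\,dF(t)$. *)

theory Defs
  imports "HOL-Probability.Probability"
begin

text \<open>
  A point is its pair of polar coordinates \<open>(r, \<theta>)\<close> with \<open>r \<in> [0, R]\<close> and \<open>\<theta> \<in> (0, 2\<pi>]\<close>.
  The parameters \<open>\<zeta>\<close>, \<open>\<alpha>\<close>, \<open>\<beta>\<close> are explicit arguments of the definitions.
\<close>

text \<open>The solution \<open>R\<close> of \<open>N = exp (\<zeta> R / 2)\<close>.\<close>

definition disc_radius :: "real \<Rightarrow> nat \<Rightarrow> real" where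
  "disc_radius \<zeta> N = 2 / \<zeta> * ln (real N)"

text \<open>The angle in \<open>[0, \<pi>]\<close> between two directions given by angles in \<open>(0, 2\<pi>]\<close>.\<close>

definition relative_angle :: "real \<Rightarrow> real \<Rightarrow> real" where
  "relative_angle \<theta>1 \<theta>2 = min \<bar>\<theta>1 - \<theta>2\<bar> (2 * pi - \<bar>\<theta>1 - \<theta>2\<bar>)"

text \<open>
  The nonnegative solution \<open>d\<close> of the hyperbolic law of cosines in curvature \<open>- \<zeta>\<^sup>2\<close>;
  see \<open>cosh_hyp_dist\<close> and \<open>hyp_dist_nonneg\<close> below.
\<close>

definition hyp_dist :: "real \<Rightarrow> real \<times> real \<Rightarrow> real \<times> real \<Rightarrow> real" where
  "hyp_dist \<zeta> u v =
     arcosh (cosh (\<zeta> * fst u) * cosh (\<zeta> * fst v)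
       - sinh (\<zeta> * fst u) * sinh (\<zeta> * fst v) * cos (relative_angle (snd u) (snd v))) / \<zeta>"

text \<open>For \<open>N = 1\<close> we have \<open>R = 0\<close>, the denominator vanishes and the density is identically 0.\<close>

definition radial_density :: "real \<Rightarrow> real \<Rightarrow> real \<Rightarrow> real" where
  "radial_density \<alpha> R r =
     (if r \<in> {0..R} then \<alpha> * sinh (\<alpha> * r) / (cosh (\<alpha> * R) - 1) else 0)"

definition point_distribution :: "real \<Rightarrow> real \<Rightarrow> (real \<times> real) measure" where
  "point_distribution \<alpha> R =
     density lborel (\<lambda>r. ennreal (radial_density \<alpha> R r)) \<Otimes>\<^sub>M uniform_measure lborel {0<..2 * pi}"

definition positions :: "real \<Rightarrow> real \<Rightarrow> nat \<Rightarrow> (nat \<Rightarrow> real \<times> real) measure" where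
  "positions \<zeta> \<alpha> N = (\<Pi>\<^sub>M i\<in>{..<N}. point_distribution \<alpha> (disc_radius \<zeta> N))"

definition connection_prob :: "real \<Rightarrow> real \<Rightarrow> real \<Rightarrow> real \<times> real \<Rightarrow> real \<times> real \<Rightarrow> real" where
  "connection_prob \<zeta> \<beta> R u v = 1 / (exp (\<beta> * (\<zeta> / 2) * (hyp_dist \<zeta> u v - R)) + 1)"

text \<open>
  A graph on the vertex set \<open>{..<N}\<close> is encoded by the indicator function of its edges,
  the edge between \<open>u < v\<close> being represented by the pair \<open>(u, v)\<close>.
\<close>

type_synonym edges = "nat \<times> nat \<Rightarrow> bool"

definition adjacent :: "edges \<Rightarrow> nat \<Rightarrow> nat \<Rightarrow> bool" where
  "adjacent G u v \<longleftrightarrow> u < v \<and> G (u, v) \<or> v < u \<and> G (v, u)"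

definition vertex_degree :: "nat \<Rightarrow> edges \<Rightarrow> nat \<Rightarrow> nat" where
  "vertex_degree N G v = card {u \<in> {..<N}. adjacent G u v}"

definition num_degree :: "nat \<Rightarrow> nat \<Rightarrow> edges \<Rightarrow> nat" where
  "num_degree N k G = card {v \<in> {..<N}. vertex_degree N G v = k}"

definition edges_given_positions ::
    "real \<Rightarrow> real \<Rightarrow> nat \<Rightarrow> (nat \<Rightarrow> real \<times> real) \<Rightarrow> edges pmf" where
  "edges_given_positions \<zeta> \<beta> N x =
     Pi_pmf {(u, v). u < v \<and> v < N} False
       (\<lambda>(u, v). bernoulli_pmf (connection_prob \<zeta> \<beta> (disc_radius \<zeta> N) (x u) (x v)))"

text \<open>The law of the random graph \<open>\<G>(N; \<zeta>, \<alpha>, \<beta>)\<close>.\<close>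

definition random_graph :: "real \<Rightarrow> real \<Rightarrow> real \<Rightarrow> nat \<Rightarrow> edges measure" where
  "random_graph \<zeta> \<alpha> \<beta> N =
     positions \<zeta> \<alpha> N \<bind> (\<lambda>x. measure_pmf (edges_given_positions \<zeta> \<beta> N x))"

definition tendsto_in_probability ::
    "(nat \<Rightarrow> 'a measure) \<Rightarrow> (nat \<Rightarrow> 'a \<Rightarrow> real) \<Rightarrow> real \<Rightarrow> bool" where
  "tendsto_in_probability M X c \<longleftrightarrow>
     (\<forall>\<epsilon>>0. (\<lambda>n. measure (M n) {\<omega> \<in> space (M n). \<bar>X n \<omega> - c\<bar> > \<epsilon>}) \<longlonglongrightarrow> 0)"

definition mixed_poisson_prob :: "(real \<Rightarrow> real) \<Rightarrow> nat \<Rightarrow> real" where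
  "mixed_poisson_prob F k = (\<integral>t. exp (- t) * t ^ k / fact k \<partial>interval_measure F)"

definition mixing_constant :: "real \<Rightarrow> real \<Rightarrow> real \<Rightarrow> real" where
  "mixing_constant \<zeta> \<alpha> \<beta> = 4 * \<alpha> / (2 * \<alpha> - \<zeta>) * (1 / \<beta>) * (1 / sin (pi / \<beta>))"

definition mixing_cdf :: "real \<Rightarrow> real \<Rightarrow> real \<Rightarrow> real \<Rightarrow> real" where
  "mixing_cdf \<zeta> \<alpha> \<beta> t =
     (let K = mixing_constant \<zeta> \<alpha> \<beta>
      in if t \<ge> K then 1 - (K / t) powr (2 * \<alpha> / \<zeta>) else 0)"

subsection \<open>Well-definedness of the model\<close>

lemma exp_disc_radius: "\<zeta> > 0 \<Longrightarrow> N > 0 \<Longrightarrow> exp (\<zeta> * disc_radius \<zeta> N / 2) = real N"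
  by (simp add: disc_radius_def)

lemma cos_relative_angle: "cos (relative_angle a b) = cos (a - b)"
proof -
  have "cos \<bar>a - b\<bar> = cos (a - b)"
    by (simp add: abs_if cos_diff)
  moreover have "cos (2 * pi - \<bar>a - b\<bar>) = cos \<bar>a - b\<bar>"
    by (simp add: cos_diff)
  ultimately show ?thesis
    by (simp add: relative_angle_def min_def)
qed

lemma hyp_law_of_cosines_ge_1:
  fixes a b t :: real
  assumes "a \<ge> 0" "b \<ge> 0"
  shows "cosh a * cosh b - sinh a * sinh b * cos t \<ge> 1"
proof -
  have "sinh a * sinh b * cos t \<le> sinh a * sinh b * 1"
    using assms by (intro mult_left_mono) auto
  moreover have "cosh a * cosh b - sinh a * sinh b = cosh (a - b)"
    by (simp add: cosh_diff)
  ultimately show ?thesis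
    using cosh_real_ge_1[of "a - b"] by linarith
qed

lemma cosh_hyp_dist:
  assumes "\<zeta> > 0" "fst u \<ge> 0" "fst v \<ge> 0"
  shows "cosh (\<zeta> * hyp_dist \<zeta> u v) =
    cosh (\<zeta> * fst u) * cosh (\<zeta> * fst v)
      - sinh (\<zeta> * fst u) * sinh (\<zeta> * fst v) * cos (relative_angle (snd u) (snd v))"
  using assms hyp_law_of_cosines_ge_1[of "\<zeta> * fst u" "\<zeta> * fst v"]
  by (simp add: hyp_dist_def)

lemma hyp_dist_nonneg:
  assumes "\<zeta> > 0" "fst u \<ge> 0" "fst v \<ge> 0"
  shows "hyp_dist \<zeta> u v \<ge> 0"
  using assms hyp_law_of_cosines_ge_1[of "\<zeta> * fst u" "\<zeta> * fst v"]
  by (simp add: hyp_dist_def)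

lemma connection_prob_bounds: "connection_prob \<zeta> \<beta> R u v \<in> {0..1}"
  by (simp add: connection_prob_def add_nonneg_nonneg add_pos_pos less_imp_le)

lemma radial_density_measurable [measurable]: "radial_density \<alpha> R \<in> borel_measurable borel"
  unfolding radial_density_def sinh_def by measurable

lemma prob_space_radial:
  assumes "\<alpha> > 0" "R > 0"
  shows "prob_space (density lborel (\<lambda>r. ennreal (radial_density \<alpha> R r)))"
proof (rule prob_spaceI)
  define c where "c = cosh (\<alpha> * R) - 1"
  have "cosh (\<alpha> * R) \<noteq> 1"
    using assms arcosh_cosh_real[of "\<alpha> * R"] by auto
  then have c: "c > 0"
    using cosh_real_ge_1[of "\<alpha> * R"] unfolding c_def by linarith
  have "(\<integral>\<^sup>+ r. ennreal (\<alpha> * sinh (\<alpha> * r) / c) * indicator {0..R} r \<partial>lborel)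
      = ennreal (cosh (\<alpha> * R) / c - cosh (\<alpha> * 0) / c)"
  proof (rule nn_integral_FTC_Icc)
    show "(\<lambda>r. \<alpha> * sinh (\<alpha> * r) / c) \<in> borel_measurable borel"
      unfolding sinh_def by measurable
    show "((\<lambda>r. cosh (\<alpha> * r) / c) has_real_derivative \<alpha> * sinh (\<alpha> * x) / c) (at x)" for x
      using c by (auto intro!: derivative_eq_intros)
  qed (use assms c in auto)
  also have "cosh (\<alpha> * R) / c - cosh (\<alpha> * 0) / c = 1"
    using c assms by (simp add: c_def diff_divide_distrib [symmetric])
  finally have "(\<integral>\<^sup>+ r. ennreal (\<alpha> * sinh (\<alpha> * r) / c) * indicator {0..R} r \<partial>lborel) = 1"
    by simp
  moreover have "(\<integral>\<^sup>+ r. ennreal (radial_density \<alpha> R r) \<partial>lborel)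
      = (\<integral>\<^sup>+ r. ennreal (\<alpha> * sinh (\<alpha> * r) / c) * indicator {0..R} r \<partial>lborel)"
    by (intro nn_integral_cong) (auto simp: radial_density_def c_def split: split_indicator)
  ultimately show "emeasure (density lborel (\<lambda>r. ennreal (radial_density \<alpha> R r)))
      (space (density lborel (\<lambda>r. ennreal (radial_density \<alpha> R r)))) = 1"
    by (simp add: emeasure_density)
qed

lemma prob_space_point_distribution:
  assumes "\<alpha> > 0" "R > 0"
  shows "prob_space (point_distribution \<alpha> R)"
proof -
  interpret A: prob_space "density lborel (\<lambda>r. ennreal (radial_density \<alpha> R r))"
    by (rule prob_space_radial[OF assms])
  interpret B: prob_space "uniform_measure lborel {0<..2 * pi}"
    by (rule prob_space_uniform_measure) auto
  interpret pair_prob_space "density lborel (\<lambda>r. ennreal (radial_density \<alpha> R r))"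
      "uniform_measure lborel {0<..2 * pi}" ..
  show ?thesis
    unfolding point_distribution_def by (rule prob_space_axioms)
qed

lemma sets_point_distribution [measurable_cong]:
  "sets (point_distribution \<alpha> R) = sets (borel \<Otimes>\<^sub>M borel)"
  unfolding point_distribution_def by (intro sets_pair_measure_cong) auto

lemma prob_space_positions:
  assumes "\<zeta> > 0" "\<alpha> > 0" "N \<ge> 2"
  shows "prob_space (positions \<zeta> \<alpha> N)"
  unfolding positions_def
  by (intro prob_space_PiM prob_space_point_distribution) (use assms in \<open>auto simp: disc_radius_def\<close>)

lemma connection_prob_measurable:
  "(\<lambda>(u, v). connection_prob \<zeta> \<beta> R u v)
     \<in> borel_measurable ((borel \<Otimes>\<^sub>M borel) \<Otimes>\<^sub>M (borel \<Otimes>\<^sub>M borel))"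
  unfolding connection_prob_def hyp_dist_def arcosh_def relative_angle_def cosh_def sinh_def
  by measurable

lemma edges_given_positions_measurable:
  "(\<lambda>x. measure_pmf (edges_given_positions \<zeta> \<beta> N x))
     \<in> positions \<zeta> \<alpha> N \<rightarrow>\<^sub>M prob_algebra (count_space UNIV)"
proof -
  define P where "P = {(u, v). u < v \<and> v < N}"
  have P: "finite P"
    by (rule finite_subset[of _ "{..<N} \<times> {..<N}"]) (auto simp: P_def)
  define S where "S = PiE_dflt P False (\<lambda>_. UNIV :: bool set)"
  have S: "finite S"
    unfolding S_def using P by (intro finite_PiE_dflt) auto
  let ?p = "\<lambda>x (u, v). connection_prob \<zeta> \<beta> (disc_radius \<zeta> N) (x u) (x v)"
  have pmf_meas: "(\<lambda>x. pmf (edges_given_positions \<zeta> \<beta> N x) G) \<in> borel_measurable (positions \<zeta> \<alpha> N)"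
    if "G \<in> S" for G
  proof -
    have "pmf (edges_given_positions \<zeta> \<beta> N x) G = (\<Prod>e\<in>P. if G e then ?p x e else 1 - ?p x e)" for x
    proof -
      have "pmf (edges_given_positions \<zeta> \<beta> N x) G
          = (\<Prod>e\<in>P. pmf (case e of (u, v) \<Rightarrow> bernoulli_pmf (?p x (u, v))) (G e))"
        unfolding edges_given_positions_def P_def[symmetric] using that P
        by (subst pmf_Pi') (auto simp: S_def PiE_dflt_def case_prod_unfold)
      also have "\<dots> = (\<Prod>e\<in>P. if G e then ?p x e else 1 - ?p x e)"
        using connection_prob_bounds by (intro prod.cong) (auto split: prod.splits)
      finally show ?thesis .
    qed
    moreover have "(\<lambda>x. ?p x e) \<in> borel_measurable (positions \<zeta> \<alpha> N)" if e: "e \<in> P" for e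
    proof -
      obtain u v where uv: "e = (u, v)" "u < N" "v < N"
        using e by (auto simp: P_def)
      have c [measurable]: "(\<lambda>x. x i) \<in> positions \<zeta> \<alpha> N \<rightarrow>\<^sub>M borel \<Otimes>\<^sub>M borel" if "i < N" for i
        using that measurable_component_singleton[of i "{..<N}"
            "\<lambda>_. point_distribution \<alpha> (disc_radius \<zeta> N)"]
        unfolding positions_def
        by (simp cong: measurable_cong_sets add: sets_point_distribution)
      have "(\<lambda>x. (x u, x v)) \<in> positions \<zeta> \<alpha> N \<rightarrow>\<^sub>M (borel \<Otimes>\<^sub>M borel) \<Otimes>\<^sub>M (borel \<Otimes>\<^sub>M borel)"
        using uv c by (intro measurable_Pair) auto
      from measurable_compose[OF this connection_prob_measurable] show ?thesis
        by (simp add: uv)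
    qed
    ultimately show ?thesis
      by (auto intro!: borel_measurable_prod borel_measurable_diff)
  qed
  show ?thesis
  proof (intro measurable_prob_algebraI measurable_subprob_algebra)
    fix A :: "edges set"
    have "emeasure (measure_pmf (edges_given_positions \<zeta> \<beta> N x)) A
        = (\<Sum>G\<in>A \<inter> S. ennreal (pmf (edges_given_positions \<zeta> \<beta> N x) G))" for x
    proof -
      have "set_pmf (edges_given_positions \<zeta> \<beta> N x) \<subseteq> S"
        unfolding edges_given_positions_def P_def[symmetric] S_def
        using set_Pi_pmf_subset[OF P] by (fastforce simp: PiE_dflt_def)
      then have "emeasure (measure_pmf (edges_given_positions \<zeta> \<beta> N x)) A
          = emeasure (measure_pmf (edges_given_positions \<zeta> \<beta> N x)) (A \<inter> S)"
        by (intro emeasure_eq_AE) (auto simp: AE_measure_pmf_iff)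
      then show ?thesis
        using S by (simp add: emeasure_measure_pmf_finite sum_ennreal)
    qed
    then show "(\<lambda>x. emeasure (measure_pmf (edges_given_positions \<zeta> \<beta> N x)) A)
        \<in> borel_measurable (positions \<zeta> \<alpha> N)"
      using pmf_meas by (auto intro!: borel_measurable_sum measurable_compose[OF _ measurable_ennreal])
  qed (auto simp: measure_pmf.prob_space_axioms measure_pmf.subprob_space_axioms)
qed

lemma prob_space_random_graph:
  assumes "\<zeta> > 0" "\<alpha> > 0" "N \<ge> 2"
  shows "prob_space (random_graph \<zeta> \<alpha> \<beta> N)"
  unfolding random_graph_def
  by (rule prob_space_bind'[OF _ edges_given_positions_measurable])
     (simp add: space_prob_algebra prob_space_positions assms)

lemma sets_random_graph: "sets (random_graph \<zeta> \<alpha> \<beta> N) = UNIV"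
proof -
  have "space (positions \<zeta> \<alpha> N) \<noteq> {}"
    by (auto simp: positions_def space_PiM PiE_eq_empty_iff point_distribution_def space_pair_measure)
  then show ?thesis
    unfolding random_graph_def
    using measurable_prob_algebraD[OF edges_given_positions_measurable] 
    by (subst sets_bind[where N = "count_space UNIV"]) auto
qed

end

theory Submission
  imports Defs
begin

text \<open>
  Let \<open>Z N s\<close> be the average of \<open>s ^ deg v\<close> over the vertices \<open>v\<close>, for \<open>s \<in> [0, 1]\<close>, and let
  \<open>p x\<close> be the probability that a vertex at \<open>x\<close> is joined to a random vertex. Given the positions
  the edges are independent, so \<open>E (Z N s) = E ((1 - (1 - s) p) ^ (N - 1))\<close>, and after dropping the edge
  between the two vertices, \<open>E ((Z N s)\<^sup>2) \<le> 1 / N + (E ((1 - (1 - s) p) ^ (N - 2)))\<^sup>2 + N E (p\<^sup>2)\<close>.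

  For a vertex at distance \<open>t\<close> from the boundary, rescaling the angle by \<open>N\<close> and dominated convergence
  give \<open>N p \<longlongrightarrow> K exp (\<zeta> t / 2)\<close>, where \<open>t\<close> is asymptotically exponential with rate \<open>\<alpha>\<close>; moreover
  \<open>N p \<le> C exp (\<zeta> t / 2)\<close>, which is integrable since \<open>\<zeta> < 2 \<alpha>\<close>. Hence \<open>N E (p\<^sup>2) \<longlongrightarrow> 0\<close> and \<open>Z N s\<close>
  converges in mean square to the generating function of the mixed Poisson law.

  Finally the indicator of \<open>d = k\<close> is a continuous function of \<open>(1 / 2) ^ d\<close>, hence by Weierstrass a uniform
  limit of linear combinations of the functions \<open>d \<mapsto> ((1 / 2) ^ j) ^ d\<close>, so that convergence of
  \<open>Z N ((1 / 2) ^ j)\<close> for all \<open>j\<close> yields convergence of the degree frequencies.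
\<close>

subsection \<open>The integral of \<open>1 / (1 + x powr b)\<close> over the half-line\<close>

text \<open>The constant \<open>K\<close> is a product of two integrals. The rescaled angle
  contributes \<open>2 / (\<beta> * sin (pi / \<beta>))\<close>, an integral of
  \<open>1 / (1 + x powr \<beta>)\<close> that Beta and Gamma functions evaluate; averaging
  \<open>exp (\<zeta> s / 2)\<close> over an exponential depth \<open>s\<close> of rate \<alpha>
  contributes \<open>2 \<alpha> / (2 \<alpha> - \<zeta>)\<close>. At an exponential depth
  \<open>t\<close> the limiting expected degree \<open>K exp (\<zeta> t / 2)\<close> is Pareto
  distributed with exponent \<open>2 \<alpha> / \<zeta>\<close>. The obstacle is that this law has
  infinite variance as soon as \<zeta> \<ge> \<alpha>, so that second moments of the degrees are not
  under control. Working with powers \<open>s ^ deg v\<close> keeps every statistic in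
  \<open>[0, 1]\<close>, and the one remaining second-order term is \<open>E (N p * p)\<close>, in
  which one factor \<open>p\<close> is bounded by 1 and tends to 0. A first-moment bound on
  \<open>N p\<close> is then enough.\<close>

lemma Gamma_reflection_real:
  fixes x :: real
  shows "Gamma x * Gamma (1 - x) = pi / sin (pi * x)"
proof -
  have "complex_of_real (Gamma x * Gamma (1 - x)) = Gamma (of_real x) * Gamma (1 - of_real x)"
    using Gamma_complex_of_real[of x] Gamma_complex_of_real[of "1 - x"] by simp
  also have "\<dots> = of_real pi / sin (of_real (pi * x))"
    by (subst Gamma_reflection_complex) simp
  also have "\<dots> = of_real (pi / sin (pi * x))"
    by (subst sin_of_real) simp
  finally have "complex_of_real (Gamma x * Gamma (1 - x)) = of_real (pi / sin (pi * x))" .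
  then show ?thesis
    by (simp only: of_real_eq_iff)
qed

text \<open>The substitution \<open>u = 1 / (1 + x powr b)\<close> maps the half-line onto the unit
  interval and turns the integral into \<open>Beta (1 - 1 / b) (1 / b) / b\<close>, which the
  reflection formula evaluates. The condition \<open>b > 1\<close> makes both Beta arguments
  positive.\<close>

lemma has_bochner_integral_inverse_one_plus_powr:
  fixes b :: real
  assumes "b > 1"
  shows "has_bochner_integral lborel (\<lambda>x. indicator {0<..} x / (1 + x powr b))
           (pi / (b * sin (pi / b)))"
proof -
  define I where "I = pi / (b * sin (pi / b))"
  define g where "g = (\<lambda>x::real. 1 / (1 + x powr b))"
  define g' where "g' = (\<lambda>x::real. - (b * x powr (b - 1)) / (1 + x powr b)\<^sup>2)"
  \<comment> \<open>The Beta integrand, normalized so that \<open>\<bar>g' x\<bar> * f (g x)\<close>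
    is the original integrand; \<open>g\<close> is the substitution and \<open>g'\<close> its
    derivative.\<close>
  define f where "f = (\<lambda>u::real. 1 / b * (u powr (- 1 / b) * (1 - u) powr (1 / b - 1)))"
  have b: "0 < 1 / b" "1 / b < 1" "b > 0"
    using assms by auto
  have pos: "1 + x powr b > 0" for x
    using powr_ge_zero[of x b] by linarith
  have sin_pos: "sin (pi / b) > 0"
    using assms by (intro sin_gt_zero) (auto simp: field_simps)
  have I_nonneg: "I \<ge> 0"
    unfolding I_def using b sin_pos by (intro divide_nonneg_pos) auto
  have "Beta (1 - 1 / b) (1 / b) = pi / sin (pi / b)"
    using Gamma_reflection_real[of "1 / b"] by (simp add: Beta_def mult.commute)
  then have "((\<lambda>t. t powr (- 1 / b) * (1 - t) powr (1 / b - 1)) has_integral pi / sin (pi / b)) {0<..<1}"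
    using has_integral_Beta_real[of "1 - 1 / b" "1 / b"] b by (simp add: has_integral_Icc_iff_Ioo)
  from has_integral_mult_right[OF this, of "1 / b"] have fI: "(f has_integral I) {0<..<1}"
    by (simp add: f_def I_def)
  have g_image: "g ` {0<..} = {0<..<1}"
  proof (intro equalityI subsetI)
    fix u assume "u \<in> g ` {0<..}"
    then obtain x where x: "x > 0" "u = 1 / (1 + x powr b)"
      by (auto simp: g_def)
    then show "u \<in> {0<..<1}"
      using pos[of x] by (simp add: divide_less_eq)
  next
    fix u :: real assume u: "u \<in> {0<..<1}"
    have "((1 / u - 1) powr (1 / b)) powr b = 1 / u - 1"
      using u b by (simp add: powr_powr field_simps)
    then have "u = g ((1 / u - 1) powr (1 / b))"
      using u by (simp add: g_def)
    moreover have "(1 / u - 1) powr (1 / b) > 0"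
      using u by (auto simp: field_simps)
    ultimately show "u \<in> g ` {0<..}"
      by blast
  qed
  have inj: "inj_on g {0<..}"
  proof (rule inj_onI)
    fix x y assume xy: "x \<in> {0<..}" "y \<in> {0<..}" "g x = g y"
    then have "x powr b = y powr b"
      using pos[of x] pos[of y] by (auto simp: g_def field_simps)
    then have "(x powr b) powr (1 / b) = (y powr b) powr (1 / b)"
      by simp
    then show "x = y"
      using xy b by (simp add: powr_powr)
  qed
  have der: "(g has_field_derivative g' x) (at x within {0<..})" if "x \<in> {0<..}" for x
    unfolding g_def g'_def using that pos[of x]
    by (auto intro!: derivative_eq_intros simp: power2_eq_square)
  have fg: "\<bar>g' x\<bar> * f (g x) = 1 / (1 + x powr b)" if x: "x > 0" for x
  proof -
    define y where "y = 1 + x powr b"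
    have y: "y > 1" "y - 1 = x powr b"
      using x by (auto simp: y_def)
    have "1 - g x = (y - 1) / y"
      using y by (simp add: g_def y_def[symmetric] field_simps)
    also have "\<dots> powr (1 / b - 1) = x powr (1 - b) / y powr (1 / b - 1)"
      using x y b by (simp add: powr_divide powr_powr right_diff_distrib)
    finally have 1: "(1 - g x) powr (1 / b - 1) = x powr (1 - b) / y powr (1 / b - 1)" .
    have 2: "g x powr (- 1 / b) = y powr (1 / b)"
      using y by (simp add: g_def y_def[symmetric] powr_divide powr_minus_divide)
    have 3: "\<bar>g' x\<bar> = b * x powr (b - 1) / y\<^sup>2"
      using b y by (simp add: g'_def y_def[symmetric])
    have 4: "x powr (b - 1) * x powr (1 - b) = 1"
      using x by (simp flip: powr_add)
    have 5: "y powr (1 / b) / y powr (1 / b - 1) = y"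
      using y by (simp flip: powr_diff)
    have "\<bar>g' x\<bar> * f (g x) = (x powr (b - 1) * x powr (1 - b)) * (y powr (1 / b) / y powr (1 / b - 1)) / y\<^sup>2"
      unfolding f_def 1 2 3 using b by (simp add: mult_ac)
    also have "\<dots> = 1 / y"
      unfolding 4 5 using y by (simp add: power2_eq_square)
    finally show ?thesis
      by (simp add: y_def)
  qed
  have "f absolutely_integrable_on g ` {0<..} \<and> integral (g ` {0<..}) f = I"
    unfolding g_image using fI b
    by (auto simp: has_integral_iff f_def intro!: nonnegative_absolutely_integrable_1)
  then have "(\<lambda>x. \<bar>g' x\<bar> * f (g x)) absolutely_integrable_on {0<..} \<and>
      integral {0<..} (\<lambda>x. \<bar>g' x\<bar> * f (g x)) = I"
    using has_absolute_integral_change_of_variables_1'[OF _ der inj, of f I] by simp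
  then have "((\<lambda>x. \<bar>g' x\<bar> * f (g x)) has_integral I) {0<..}"
    using absolutely_integrable_on_def has_integral_iff by blast
  then have "((\<lambda>x. 1 / (1 + x powr b)) has_integral I) {0<..}"
    by (rule has_integral_eq[rotated]) (simp add: fg)
  \<comment> \<open>The change of variables yields a gauge integral; nonnegativity of the integrand
    transfers its value to the Lebesgue integral.\<close>
  then have "(\<integral>\<^sup>+ x. ennreal (indicator {0<..} x * (1 / (1 + x powr b))) \<partial>lborel) = ennreal I"
    using pos by (intro nn_integral_has_integral_lebesgue) (auto simp: less_imp_le)
  then show ?thesis
    using pos I_nonneg unfolding I_def[symmetric]
    by (intro has_bochner_integral_nn_integral) (auto simp: less_imp_le)
qed

lemma has_bochner_integral_inverse_one_plus_powr_scaled: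
  fixes a b :: real
  assumes "b > 1" "a > 0"
  shows "has_bochner_integral lborel (\<lambda>x. indicator {0<..} x / (1 + (a * x) powr b))
           (pi / (b * sin (pi / b)) / a)"
proof -
  have "has_bochner_integral lborel (\<lambda>x. indicator {0<..} (a * x) / (1 + (a * x) powr b))
           (pi / (b * sin (pi / b)) /\<^sub>R \<bar>a\<bar>)"
    using has_bochner_integral_inverse_one_plus_powr[OF assms(1)] assms(2)
    by (subst (asm) lborel_has_bochner_integral_real_affine_iff[where c = a and t = 0]) auto
  moreover have "indicator {0<..} (a * x) = (indicator {0<..} x :: real)" for x
    using assms by (auto simp: indicator_def zero_less_mult_iff)
  ultimately show ?thesis
    using assms by (simp add: field_simps)
qed

subsection \<open>Connection probabilities near the boundary of the disc\<close>

text \<open>Jordan's inequality: sine is concave on \<open>[0, pi / 2]\<close> and therefore lies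
  above its chord, with \<open>2 * x / pi\<close> as the weight of the right endpoint.\<close>

lemma sin_ge_two_div_pi:
  fixes x :: real
  assumes "0 \<le> x" "x \<le> pi / 2"
  shows "2 * x / pi \<le> sin x"
proof -
  have "convex_on {0..pi / 2} (\<lambda>x. - sin x)"
  proof (rule f''_ge0_imp_convex)
    show "((\<lambda>x. - sin x) has_real_derivative - cos x) (at x)" for x :: real
      by (auto intro!: derivative_eq_intros)
    show "((\<lambda>x. - cos x) has_real_derivative sin x) (at x)" for x :: real
      by (auto intro!: derivative_eq_intros)
  qed (auto intro!: sin_ge_zero)
  from convex_onD[OF this, of "2 * x / pi" 0 "pi / 2"] show ?thesis
    using assms by (auto simp: field_simps)
qed

text \<open>Jordan's inequality at \<open>x / 2\<close> and the half-angle formula would give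
  \<open>1 - 2 * (x / pi)\<^sup>2\<close>. The weaker right-hand side is nonnegative on all of
  \<open>[0, pi]\<close>, as the replacement of \<open>sinh\<close> by \<open>cosh\<close> in
  \<open>exp_hyp_dist_ge\<close> requires.\<close>

lemma cos_le_one_minus_square:
  fixes x :: real
  assumes "0 \<le> x" "x \<le> pi"
  shows "cos x \<le> 1 - (x / pi)\<^sup>2"
proof -
  have "x / pi \<le> sin (x / 2)"
    using sin_ge_two_div_pi[of "x / 2"] assms by simp
  then have "(x / pi)\<^sup>2 \<le> (sin (x / 2))\<^sup>2"
    using assms by (intro power_mono) auto
  moreover have "cos x = 1 - 2 * (sin (x / 2))\<^sup>2"
    using cos_double_sin[of "x / 2"] by simp
  ultimately show ?thesis
    using zero_le_power2[of "x / pi"] by linarith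
qed

text \<open>Unlike the limit in \<open>tendsto_exp_hyp_dist\<close>, this bound is uniform in radii
  and angle, as a dominating function needs. Replacing \<open>sinh\<close> by \<open>cosh\<close> in
  the subtracted term of the law of cosines leaves \<open>cosh (\<zeta> * r) * cosh (\<zeta> * s) *
  (\<theta> / pi)\<^sup>2\<close>; the further factor \<open>1 / 4\<close> comes from using
  \<open>cosh x \<ge> exp x / 2\<close> twice.\<close>

lemma exp_hyp_dist_ge:
  assumes "\<zeta> > 0" "r \<ge> 0" "s \<ge> 0" "0 \<le> \<theta>" "\<theta> \<le> pi"
  shows "(\<theta> / (2 * pi))\<^sup>2 * exp (\<zeta> * (r + s)) \<le> exp (\<zeta> * hyp_dist \<zeta> (r, 0) (s, \<theta>))"
proof -
  define d where "d = hyp_dist \<zeta> (r, 0) (s, \<theta>)"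
  define x where "x = (\<theta> / pi)\<^sup>2"
  have x: "0 \<le> x" "x \<le> 1"
    unfolding x_def using assms by (auto intro!: power_le_one)
  have ss: "0 \<le> sinh (\<zeta> * r) * sinh (\<zeta> * s)"
    using assms by simp
  have "sinh (\<zeta> * r) * sinh (\<zeta> * s) * cos \<theta> \<le> sinh (\<zeta> * r) * sinh (\<zeta> * s) * (1 - x)"
    using cos_le_one_minus_square[of \<theta>] assms ss by (intro mult_left_mono) (auto simp: x_def)
  also have "\<dots> \<le> cosh (\<zeta> * r) * cosh (\<zeta> * s) * (1 - x)"
    using x assms by (intro mult_right_mono mult_mono sinh_le_cosh_real) auto
  finally have "cosh (\<zeta> * r) * cosh (\<zeta> * s) * x \<le> cosh (\<zeta> * d)"
    using cosh_hyp_dist[of \<zeta> "(r, 0)" "(s, \<theta>)"] assms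
    by (simp add: d_def cos_relative_angle algebra_simps)
  moreover have "exp (\<zeta> * (r + s)) / 4 \<le> cosh (\<zeta> * r) * cosh (\<zeta> * s)"
  proof -
    have "exp (\<zeta> * r) / 2 * (exp (\<zeta> * s) / 2) \<le> cosh (\<zeta> * r) * cosh (\<zeta> * s)"
      by (intro mult_mono) (auto simp: cosh_def)
    then show ?thesis
      by (simp add: exp_add distrib_left)
  qed
  ultimately have "exp (\<zeta> * (r + s)) / 4 * x \<le> cosh (\<zeta> * d)"
    using x mult_right_mono by fastforce
  also have "\<dots> \<le> exp (\<zeta> * d)"
    using hyp_dist_nonneg[of \<zeta> "(r, 0)" "(s, \<theta>)"] assms by (simp add: d_def cosh_def)
  finally show ?thesis
    by (simp add: d_def x_def power_divide power_mult_distrib mult.commute)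
qed

text \<open>Isolates \<open>exp (\<zeta> * d) / exp (\<zeta> * R)\<close>, the quantity that both
  the uniform bound and the limit control. Both compare it with a square, and the exponent
  \<open>\<beta> / 2\<close> takes the root.\<close>

lemma connection_prob_eq_powr:
  "connection_prob \<zeta> \<beta> R u v
     = 1 / (1 + (exp (\<zeta> * hyp_dist \<zeta> u v) / exp (\<zeta> * R)) powr (\<beta> / 2))"
proof -
  have "\<beta> * (\<zeta> / 2) * (hyp_dist \<zeta> u v - R) = \<beta> / 2 * (\<zeta> * hyp_dist \<zeta> u v - \<zeta> * R)"
    by (simp add: right_diff_distrib diff_divide_distrib)
  then show ?thesis
    by (simp add: connection_prob_def powr_def ln_div add.commute)
qed

lemma exp_half_square: "(exp (x / 2 :: real))\<^sup>2 = exp x"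
  by (simp flip: exp_double)

lemma square_powr_half:
  fixes x b :: real
  assumes "x \<ge> 0"
  shows "x\<^sup>2 powr (b / 2) = x powr b"
proof -
  have "x\<^sup>2 = x powr 2"
    using assms by simp
  then show ?thesis
    by (simp only: powr_powr) simp
qed

text \<open>The right-hand side has the shape \<open>1 / (1 + (a * \<theta>) powr \<beta>)\<close>
  of the integral evaluated above. For points at depths \<open>t\<close> and \<open>t'\<close> below
  the boundary, \<open>exp (\<zeta> * R / 2) = N\<close> gives
  \<open>a = N * exp (- \<zeta> * (t + t') / 2) / (2 * pi)\<close>, so the relevant angles have
  order \<open>1 / N\<close>.\<close>

lemma connection_prob_le:
  assumes "\<zeta> > 0" "\<beta> > 0" "r \<ge> 0" "s \<ge> 0" "0 \<le> \<theta>" "\<theta> \<le> pi"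
  shows "connection_prob \<zeta> \<beta> R (r, 0) (s, \<theta>)
     \<le> 1 / (1 + (exp (\<zeta> * (r + s - R) / 2) / (2 * pi) * \<theta>) powr \<beta>)"
proof -
  define E where "E = exp (\<zeta> * hyp_dist \<zeta> (r, 0) (s, \<theta>)) / exp (\<zeta> * R)"
  have "(exp (\<zeta> * (r + s - R) / 2) / (2 * pi) * \<theta>)\<^sup>2
      = (\<theta> / (2 * pi))\<^sup>2 * exp (\<zeta> * (r + s)) / exp (\<zeta> * R)"
    by (simp add: power_mult_distrib power_divide exp_half_square)
      (simp add: right_diff_distrib exp_diff mult_ac)
  also have "\<dots> \<le> E"
    unfolding E_def using exp_hyp_dist_ge assms by (intro divide_right_mono) auto
  finally have "(exp (\<zeta> * (r + s - R) / 2) / (2 * pi) * \<theta>)\<^sup>2 powr (\<beta> / 2) \<le> E powr (\<beta> / 2)"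
    using assms by (intro powr_mono2) auto
  then have "(exp (\<zeta> * (r + s - R) / 2) / (2 * pi) * \<theta>) powr \<beta> \<le> E powr (\<beta> / 2)"
    using assms by (subst (asm) square_powr_half) auto
  then show ?thesis
    unfolding connection_prob_eq_powr E_def[symmetric]
    by (intro divide_left_mono add_left_mono mult_pos_pos add_pos_nonneg) auto
qed

section \<open>Asymptotic distance of two points near the boundary at an angle of order
  \<open>1 / N\<close>\<close>

lemma filterlim_disc_radius:
  assumes "\<zeta> > 0"
  shows "filterlim (disc_radius \<zeta>) at_top sequentially"
  unfolding disc_radius_def
  by (rule filterlim_tendsto_pos_mult_at_top[OF tendsto_const])
    (use assms in \<open>auto intro!: filterlim_compose[OF ln_at_top filterlim_real_sequentially]\<close>)

lemma exp_mult_disc_radius: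
  assumes "\<zeta> > 0" "N > 0"
  shows "exp (\<zeta> * disc_radius \<zeta> N) = (real N)\<^sup>2"
  using exp_disc_radius[OF assms] exp_double[of "\<zeta> * disc_radius \<zeta> N / 2"] by simp

lemma tendsto_mult_sin_over:
  fixes c :: real
  shows "(\<lambda>n. real n * sin (c / real n)) \<longlonglongrightarrow> c"
proof -
  have "DERIV (\<lambda>h. sin (c * h)) 0 :> c"
    by (auto intro!: derivative_eq_intros)
  then have "((\<lambda>h. sin (c * h) / h) \<longlongrightarrow> c) (at 0)"
    by (simp add: DERIV_def)
  moreover have "filterlim (\<lambda>n. 1 / real n) (at 0) sequentially"
    by (intro filterlim_atI lim_1_over_n) (auto intro!: eventually_sequentiallyI[of 1])
  ultimately have "(\<lambda>n. sin (c * (1 / real n)) / (1 / real n)) \<longlonglongrightarrow> c"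
    by (rule filterlim_compose)
  then show ?thesis
    by (simp add: mult.commute)
qed

text \<open>As \<open>exp (\<zeta> * R) = N\<^sup>2\<close>, the growing exponential is exactly
  \<open>N\<^sup>2 * exp (- \<zeta> * t)\<close>, and the decaying one contributes only order
  \<open>1 / N ^ 4\<close> after the division.\<close>

lemma tendsto_sinh_over_square:
  assumes "\<zeta> > 0"
  shows "(\<lambda>N. sinh (\<zeta> * (disc_radius \<zeta> N - t)) / (real N)\<^sup>2) \<longlonglongrightarrow> exp (- \<zeta> * t) / 2"
proof (rule Lim_transform_eventually)
  have "(\<lambda>N. (exp (- \<zeta> * t) - exp (\<zeta> * t) * (1 / real N) ^ 4) / 2)
      \<longlonglongrightarrow> (exp (- \<zeta> * t) - exp (\<zeta> * t) * 0 ^ 4) / 2"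
    by (intro tendsto_intros lim_1_over_n) auto
  then show "(\<lambda>N. (exp (- \<zeta> * t) - exp (\<zeta> * t) * (1 / real N) ^ 4) / 2) \<longlonglongrightarrow> exp (- \<zeta> * t) / 2"
    by simp
  show "\<forall>\<^sub>F N in sequentially. (exp (- \<zeta> * t) - exp (\<zeta> * t) * (1 / real N) ^ 4) / 2
      = sinh (\<zeta> * (disc_radius \<zeta> N - t)) / (real N)\<^sup>2"
    using eventually_gt_at_top[of 0]
  proof eventually_elim
    case (elim N)
    define m where "m = (real N)\<^sup>2"
    have m: "m > 0" "(1 / real N) ^ 4 = 1 / m\<^sup>2"
      using elim by (auto simp: m_def power_divide)
    have "sinh (\<zeta> * (disc_radius \<zeta> N - t)) = (m * exp (- \<zeta> * t) - exp (\<zeta> * t) / m) / 2"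
    proof -
      have m': "exp (\<zeta> * disc_radius \<zeta> N) = m"
        using exp_mult_disc_radius[OF assms, of N] elim by (simp add: m_def)
      have "exp (\<zeta> * (disc_radius \<zeta> N - t)) = m * exp (- \<zeta> * t)"
        unfolding m'[symmetric] by (simp add: algebra_simps flip: exp_add)
      moreover have "exp (- (\<zeta> * (disc_radius \<zeta> N - t))) = exp (\<zeta> * t) / m"
        unfolding m'[symmetric] by (simp add: algebra_simps flip: exp_diff)
      ultimately show ?thesis
        by (simp add: sinh_field_def)
    qed
    then show ?case
      unfolding m_def[symmetric] using m by (simp add: diff_divide_distrib power2_eq_square)
  qed
qed

text \<open>At fixed depths and angles of order \<open>1 / N\<close>, the two products in the law of
  cosines have order \<open>N ^ 4\<close>, but their difference only \<open>N\<^sup>2\<close>.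
  Writing the cosine through \<open>sin (\<theta> / 2)\<close> removes this cancellation, and
  \<open>exp (arcosh X) = X + sqrt (X\<^sup>2 - 1)\<close> removes the inverse function.\<close>

lemma exp_mult_hyp_dist:
  assumes "\<zeta> > 0" "r \<ge> 0" "s \<ge> 0"
  shows "exp (\<zeta> * hyp_dist \<zeta> (r, 0) (s, \<theta>)) =
    (let X = cosh (\<zeta> * (r - s)) + 2 * sinh (\<zeta> * r) * sinh (\<zeta> * s) * (sin (\<theta> / 2))\<^sup>2
     in X + sqrt (X\<^sup>2 - 1))"
proof -
  have "cos (relative_angle 0 \<theta>) = 1 - 2 * (sin (\<theta> / 2))\<^sup>2"
    using cos_double_sin[of "\<theta> / 2"] by (simp add: cos_relative_angle)
  then have *: "cosh (\<zeta> * r) * cosh (\<zeta> * s) - sinh (\<zeta> * r) * sinh (\<zeta> * s) * cos (relative_angle 0 \<theta>)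
      = cosh (\<zeta> * (r - s)) + 2 * sinh (\<zeta> * r) * sinh (\<zeta> * s) * (sin (\<theta> / 2))\<^sup>2" (is "?X = _")
    by (simp only:) (simp add: cosh_diff algebra_simps)
  have X: "?X \<ge> 1"
    using assms by (intro hyp_law_of_cosines_ge_1) auto
  then have "?X + sqrt (?X\<^sup>2 - 1) > 0"
    by (intro add_pos_nonneg) auto
  then show ?thesis
    using assms X unfolding *[symmetric] Let_def by (simp add: hyp_dist_def arcosh_real_def)
qed

lemma tendsto_exp_hyp_dist:
  assumes "\<zeta> > 0" 
  shows "(\<lambda>N. exp (\<zeta> * hyp_dist \<zeta> (disc_radius \<zeta> N - t, 0) (disc_radius \<zeta> N - s, \<phi> / real N))
            / exp (\<zeta> * disc_radius \<zeta> N)) \<longlonglongrightarrow> (\<phi> / 2 * exp (- \<zeta> * (t + s) / 2))\<^sup>2"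
proof (rule Lim_transform_eventually)
  \<comment> \<open>\<open>Y N\<close> is \<open>X / N\<^sup>2\<close> for the \<open>X\<close> of
    \<open>exp_mult_hyp_dist\<close>, with the powers of \<open>N\<close> distributed so that every
    factor converges. The \<open>1\<close> under the root becomes \<open>(1 / N) ^ 4\<close> under
    the same division, and the limit of the whole expression is \<open>2 * L\<close>.\<close>
  define Y where "Y = (\<lambda>N. cosh (\<zeta> * (s - t)) * (1 / real N)\<^sup>2
    + 2 * (sinh (\<zeta> * (disc_radius \<zeta> N - t)) / (real N)\<^sup>2) * (sinh (\<zeta> * (disc_radius \<zeta> N - s)) / (real N)\<^sup>2)
        * (real N * sin ((\<phi> / 2) / real N))\<^sup>2)"
  define L where "L = \<phi>\<^sup>2 / 8 * exp (- \<zeta> * (t + s))"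
  have "Y \<longlonglongrightarrow> cosh (\<zeta> * (s - t)) * 0\<^sup>2 + 2 * (exp (- \<zeta> * t) / 2) * (exp (- \<zeta> * s) / 2) * (\<phi> / 2)\<^sup>2"
    unfolding Y_def
    by (intro tendsto_intros lim_1_over_n tendsto_sinh_over_square tendsto_mult_sin_over assms)
  moreover have "cosh (\<zeta> * (s - t)) * 0\<^sup>2 + 2 * (exp (- \<zeta> * t) / 2) * (exp (- \<zeta> * s) / 2) * (\<phi> / 2)\<^sup>2 = L"
    by (simp add: L_def power_divide right_diff_distrib exp_diff exp_minus field_simps exp_add)
  ultimately have "Y \<longlonglongrightarrow> L"
    by simp
  then have "(\<lambda>N. Y N + sqrt ((Y N)\<^sup>2 - (1 / real N) ^ 4)) \<longlonglongrightarrow> L + sqrt (L\<^sup>2 - 0 ^ 4)"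
    by (intro tendsto_intros lim_1_over_n)
  moreover have "L + sqrt (L\<^sup>2 - 0 ^ 4) = (\<phi> / 2 * exp (- \<zeta> * (t + s) / 2))\<^sup>2"
  proof -
    have "sqrt (L\<^sup>2 - 0 ^ 4) = L"
      by (simp add: L_def)
    then show ?thesis
      using exp_half_square[of "- \<zeta> * (t + s)"] by (simp add: L_def power_mult_distrib power_divide)
  qed
  ultimately show "(\<lambda>N. Y N + sqrt ((Y N)\<^sup>2 - (1 / real N) ^ 4)) \<longlonglongrightarrow> (\<phi> / 2 * exp (- \<zeta> * (t + s) / 2))\<^sup>2"
    by simp
  have "\<forall>\<^sub>F N in sequentially. disc_radius \<zeta> N \<ge> max t s"
    using filterlim_disc_radius[OF assms] unfolding filterlim_at_top by blast
  then show "\<forall>\<^sub>F N in sequentially. Y N + sqrt ((Y N)\<^sup>2 - (1 / real N) ^ 4)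
      = exp (\<zeta> * hyp_dist \<zeta> (disc_radius \<zeta> N - t, 0) (disc_radius \<zeta> N - s, \<phi> / real N))
            / exp (\<zeta> * disc_radius \<zeta> N)"
    using eventually_gt_at_top[of 0]
  proof eventually_elim
    case (elim N)
    define X where "X = cosh (\<zeta> * (s - t))
      + 2 * sinh (\<zeta> * (disc_radius \<zeta> N - t)) * sinh (\<zeta> * (disc_radius \<zeta> N - s)) * (sin (\<phi> / real N / 2))\<^sup>2"
    have Y: "Y N = X / (real N)\<^sup>2"
      using elim by (simp add: Y_def X_def power_divide power_mult_distrib field_simps)
    have "(Y N)\<^sup>2 - (1 / real N) ^ 4 = (X\<^sup>2 - 1) / ((real N)\<^sup>2)\<^sup>2"
      by (simp add: Y power_divide diff_divide_distrib)
    then have "sqrt ((Y N)\<^sup>2 - (1 / real N) ^ 4) = sqrt (X\<^sup>2 - 1) / (real N)\<^sup>2"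
      by (simp only: real_sqrt_divide real_sqrt_abs) simp
    then have "Y N + sqrt ((Y N)\<^sup>2 - (1 / real N) ^ 4) = (X + sqrt (X\<^sup>2 - 1)) / (real N)\<^sup>2"
      by (simp add: Y add_divide_distrib)
    then show ?case
      using exp_mult_hyp_dist[OF assms, of "disc_radius \<zeta> N - t" "disc_radius \<zeta> N - s" "\<phi> / real N"] elim
        exp_mult_disc_radius[OF assms, of N]
      by (simp add: Let_def X_def)
  qed
qed

lemma tendsto_connection_prob:
  assumes "\<zeta> > 0" "\<beta> > 0" "\<phi> > 0"
  shows "(\<lambda>N. connection_prob \<zeta> \<beta> (disc_radius \<zeta> N) (disc_radius \<zeta> N - t, 0) (disc_radius \<zeta> N - s, \<phi> / real N))
    \<longlonglongrightarrow> 1 / (1 + (exp (- \<zeta> * (t + s) / 2) / 2 * \<phi>) powr \<beta>)"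
proof -
  have "(\<lambda>N. connection_prob \<zeta> \<beta> (disc_radius \<zeta> N) (disc_radius \<zeta> N - t, 0) (disc_radius \<zeta> N - s, \<phi> / real N))
    \<longlonglongrightarrow> 1 / (1 + ((\<phi> / 2 * exp (- \<zeta> * (t + s) / 2))\<^sup>2) powr (\<beta> / 2))"
    unfolding connection_prob_eq_powr using assms powr_ge_zero[of "(\<phi> / 2 * exp (- \<zeta> * (t + s) / 2))\<^sup>2" "\<beta> / 2"]
    by (intro tendsto_intros tendsto_exp_hyp_dist) (auto simp del: powr_ge_zero)
  then show ?thesis
    using assms by (subst (asm) square_powr_half) (auto simp: mult.commute)
qed

subsection \<open>Connection probabilities averaged over one endpoint\<close>

text \<open>The bounds below hold only for large \<open>N\<close>, for instance once
  \<open>R\<close> exceeds the depths involved; discarding finitely many indices leads back to the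
  usual dominated convergence theorem.\<close>

lemma integral_dominated_convergence_eventually:
  fixes s :: "nat \<Rightarrow> 'a \<Rightarrow> real"
  assumes "f \<in> borel_measurable M" "\<And>i. s i \<in> borel_measurable M" "integrable M w"
    and "AE x in M. (\<lambda>i. s i x) \<longlonglongrightarrow> f x"
    and "\<forall>\<^sub>F i in sequentially. \<forall>x. \<bar>s i x\<bar> \<le> w x"
  shows "(\<lambda>i. integral\<^sup>L M (s i)) \<longlonglongrightarrow> integral\<^sup>L M f"
proof -
  from assms(5) obtain k where k: "\<And>i x. i \<ge> k \<Longrightarrow> \<bar>s i x\<bar> \<le> w x"
    by (auto simp: eventually_sequentially)
  have "(\<lambda>i. integral\<^sup>L M (s (i + k))) \<longlonglongrightarrow> integral\<^sup>L M f"
  proof (rule integral_dominated_convergence)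
    show "AE x in M. (\<lambda>i. s (i + k) x) \<longlonglongrightarrow> f x"
      using assms(4) by eventually_elim (rule LIMSEQ_ignore_initial_segment)
  qed (use assms k in auto)
  then show ?thesis
    by (rule LIMSEQ_offset)
qed

lemma connection_prob_measurable' [measurable]:
  assumes [measurable]: "f \<in> M \<rightarrow>\<^sub>M borel \<Otimes>\<^sub>M borel" "g \<in> M \<rightarrow>\<^sub>M borel \<Otimes>\<^sub>M borel"
  shows "(\<lambda>x. connection_prob \<zeta> \<beta> R (f x) (g x)) \<in> borel_measurable M"
proof -
  have "(\<lambda>x. (f x, g x)) \<in> M \<rightarrow>\<^sub>M (borel \<Otimes>\<^sub>M borel) \<Otimes>\<^sub>M (borel \<Otimes>\<^sub>M borel)"
    by measurable
  from measurable_compose[OF this connection_prob_measurable] show ?thesis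
    by simp
qed

lemma connection_prob_nonneg: "0 \<le> connection_prob \<zeta> \<beta> R u v"
  and connection_prob_le_1: "connection_prob \<zeta> \<beta> R u v \<le> 1"
  using connection_prob_bounds[of \<zeta> \<beta> R u v] by auto

text \<open>The relative angle of two independent uniform directions is uniform on
  \<open>[0, pi]\<close>, so one endpoint is placed at angle 0;
  \<open>integral_uniform_angle\<close> justifies this.\<close>

definition angular_connection_prob :: "real \<Rightarrow> real \<Rightarrow> real \<Rightarrow> real \<Rightarrow> real \<Rightarrow> real" where
  "angular_connection_prob \<zeta> \<beta> R r s =
     (\<integral>\<theta>. indicator {0<..pi} \<theta> * connection_prob \<zeta> \<beta> R (r, 0) (s, \<theta>) \<partial>lborel) / pi"

text \<open>This is the \<open>p\<close> of the overview, as a function of the radius alone;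
  \<open>integral_connection_prob\<close> makes the identification.\<close>

definition radial_connection_prob :: "real \<Rightarrow> real \<Rightarrow> real \<Rightarrow> real \<Rightarrow> real \<Rightarrow> real" where
  "radial_connection_prob \<zeta> \<alpha> \<beta> R r =
     (\<integral>s. radial_density \<alpha> R s * angular_connection_prob \<zeta> \<beta> R r s \<partial>lborel)"

lemma angular_connection_prob_measurable [measurable]:
  assumes [measurable]: "f \<in> borel_measurable M" "g \<in> borel_measurable M"
  shows "(\<lambda>x. angular_connection_prob \<zeta> \<beta> R (f x) (g x)) \<in> borel_measurable M"
  unfolding angular_connection_prob_def by measurable

lemma radial_connection_prob_measurable [measurable]:
  "radial_connection_prob \<zeta> \<alpha> \<beta> R \<in> borel_measurable borel"
  unfolding radial_connection_prob_def[abs_def] by measurable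

lemma angular_connection_prob_nonneg: "0 \<le> angular_connection_prob \<zeta> \<beta> R r s"
  unfolding angular_connection_prob_def
  by (intro divide_nonneg_pos Bochner_Integration.integral_nonneg) (auto simp: connection_prob_nonneg)

text \<open>The substitution \<theta> = \<phi> / N absorbs the factor \<open>N\<close> and stretches
  the range of integration towards the half-line.\<close>

lemma mult_angular_connection_prob_eq:
  assumes "N > 0"
  shows "real N * angular_connection_prob \<zeta> \<beta> R r s =
    (\<integral>\<phi>. indicator {0<..real N * pi} \<phi> * connection_prob \<zeta> \<beta> R (r, 0) (s, \<phi> / real N) \<partial>lborel) / pi"
proof -
  have "indicator {0<..pi} (x / real N) = (indicator {0<..real N * pi} x :: real)" for x
    using assms by (auto simp: indicator_def field_simps)
  then show ?thesis
    unfolding angular_connection_prob_def using assms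
    by (subst lborel_integral_real_affine[where c = "1 / real N" and t = 0]) auto
qed

lemma has_bochner_integral_exp_half_line:
  fixes a :: real
  assumes "a > 0"
  shows "has_bochner_integral lborel (\<lambda>t. indicator {0..} t * exp (- a * t)) (1 / a)"
proof -
  interpret prob_space "density lborel (exponential_density a)"
    by (rule prob_space_exponential_density[OF assms])
  have "(\<integral>\<^sup>+ t. ennreal (exponential_density a t) \<partial>lborel) = ennreal 1"
    using emeasure_space_1 by (simp add: emeasure_density)
  then have "has_bochner_integral lborel (exponential_density a) 1"
    using assms by (intro has_bochner_integral_nn_integral) (auto simp: exponential_density_nonneg)
  from has_bochner_integral_mult_right[OF this, of "1 / a"] show ?thesis
    by (rule has_bochner_integral_cong[THEN iffD1, rotated 3])
      (use assms in \<open>auto simp: exponential_density_def indicator_def mult.commute\<close>)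
qed

text \<open>Two of the inequalities are convergence conditions: \<open>\<beta> > 1\<close> for the
  integral over the rescaled angle, and \<open>\<zeta> < 2 * \<alpha>\<close> for the integral of
  \<open>exp (\<zeta> * s / 2)\<close> over the exponential depth \<open>s\<close>.\<close>

locale hyperbolic_parameters =
  fixes \<zeta> \<alpha> \<beta> :: real
  assumes params: "\<zeta> > 0" "\<alpha> > 0" "\<beta> > 1" "\<zeta> < 2 * \<alpha>"
begin

lemma exp_neg_half: "exp (- \<zeta> * x / 2) = 1 / exp (\<zeta> * x / 2)" for x
  by (simp add: exp_minus inverse_eq_divide)

lemma scaled_connection_prob_le:
  assumes "N > 0" "t \<le> disc_radius \<zeta> N" "s \<le> disc_radius \<zeta> N"
  shows "indicator {0<..real N * pi} \<phi> *
      connection_prob \<zeta> \<beta> (disc_radius \<zeta> N) (disc_radius \<zeta> N - t, 0) (disc_radius \<zeta> N - s, \<phi> / real N)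
    \<le> indicator {0<..} \<phi> / (1 + (exp (- \<zeta> * (t + s) / 2) / (2 * pi) * \<phi>) powr \<beta>)"
proof (cases "\<phi> \<in> {0<..real N * pi}")
  case True
  \<comment> \<open>The radii add up to \<open>2 * R - t - s\<close>, so subtracting
    \<open>R\<close> leaves one factor \<open>exp (\<zeta> * R / 2) = N\<close>, which cancels the
    \<open>1 / N\<close> of the rescaled angle.\<close>
  have "exp (\<zeta> * (disc_radius \<zeta> N - t + (disc_radius \<zeta> N - s) - disc_radius \<zeta> N) / 2)
      = exp (\<zeta> * disc_radius \<zeta> N / 2) * exp (- \<zeta> * (t + s) / 2)"
    by (simp flip: exp_add) (simp add: field_simps)
  also have "\<dots> = real N * exp (- \<zeta> * (t + s) / 2)"
    using params assms by (simp add: exp_disc_radius)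
  finally have "connection_prob \<zeta> \<beta> (disc_radius \<zeta> N) (disc_radius \<zeta> N - t, 0) (disc_radius \<zeta> N - s, \<phi> / real N)
      \<le> 1 / (1 + (real N * exp (- \<zeta> * (t + s) / 2) / (2 * pi) * (\<phi> / real N)) powr \<beta>)"
    using connection_prob_le[of \<zeta> \<beta> "disc_radius \<zeta> N - t" "disc_radius \<zeta> N - s" "\<phi> / real N" "disc_radius \<zeta> N"]
      params assms True by (simp add: field_simps)
  then show ?thesis
    using True assms by simp
next
  case False
  have "0 \<le> indicator {0<..} \<phi> / (1 + (exp (- \<zeta> * (t + s) / 2) / (2 * pi) * \<phi>) powr \<beta>)"
    by (intro divide_nonneg_nonneg add_nonneg_nonneg) auto
  then show ?thesis
    using False by simp
qed

text \<open>Uniform in \<open>N\<close> and in all depths up to \<open>R\<close>. The constant is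
  \<open>pi\<close> times the limit found next, the price of the crude estimates in
  \<open>exp_hyp_dist_ge\<close>.\<close>

lemma mult_angular_connection_prob_le:
  assumes "N > 0" "t \<le> disc_radius \<zeta> N" "s \<le> disc_radius \<zeta> N"
  shows "real N * angular_connection_prob \<zeta> \<beta> (disc_radius \<zeta> N) (disc_radius \<zeta> N - t) (disc_radius \<zeta> N - s)
    \<le> 2 * (pi / (\<beta> * sin (pi / \<beta>))) * exp (\<zeta> * (t + s) / 2)"
proof -
  let ?c = "\<lambda>\<phi>. indicator {0<..real N * pi} \<phi> *
      connection_prob \<zeta> \<beta> (disc_radius \<zeta> N) (disc_radius \<zeta> N - t, 0) (disc_radius \<zeta> N - s, \<phi> / real N)"
  have I: "has_bochner_integral lborel
      (\<lambda>\<phi>. indicator {0<..} \<phi> / (1 + (exp (- \<zeta> * (t + s) / 2) / (2 * pi) * \<phi>) powr \<beta>))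
      (pi / (\<beta> * sin (pi / \<beta>)) / (exp (- \<zeta> * (t + s) / 2) / (2 * pi)))" (is "has_bochner_integral _ ?w _")
    using params by (intro has_bochner_integral_inverse_one_plus_powr_scaled) auto
  have le: "?c \<phi> \<le> ?w \<phi>" for \<phi>
    using assms by (intro scaled_connection_prob_le)
  have nonneg: "0 \<le> ?c \<phi>" for \<phi>
    by (simp add: connection_prob_nonneg)
  have "integrable lborel ?c"
    using integrable.intros[OF I]
    by (rule Bochner_Integration.integrable_bound) (use nonneg le in \<open>auto intro!: AE_I2 intro: order_trans[OF _ abs_ge_self]\<close>)
  then have "integral\<^sup>L lborel ?c \<le> integral\<^sup>L lborel ?w"
    using I le by (intro integral_mono) (auto simp: has_bochner_integral_iff)
  also have "\<dots> = pi / (\<beta> * sin (pi / \<beta>)) / (exp (- \<zeta> * (t + s) / 2) / (2 * pi))"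
    using I by (simp add: has_bochner_integral_iff)
  finally have "integral\<^sup>L lborel ?c / pi \<le> pi / (\<beta> * sin (pi / \<beta>)) / (exp (- \<zeta> * (t + s) / 2) / (2 * pi)) / pi"
    by (intro divide_right_mono) auto
  also have "\<dots> = 2 * (pi / (\<beta> * sin (pi / \<beta>))) * exp (\<zeta> * (t + s) / 2)"
    unfolding exp_neg_half by simp
  finally show ?thesis
    using assms by (simp add: mult_angular_connection_prob_eq)
qed

lemma tendsto_mult_angular_connection_prob:
  "(\<lambda>N. real N * angular_connection_prob \<zeta> \<beta> (disc_radius \<zeta> N) (disc_radius \<zeta> N - t) (disc_radius \<zeta> N - s))
    \<longlonglongrightarrow> 2 / (\<beta> * sin (pi / \<beta>)) * exp (\<zeta> * (t + s) / 2)"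
proof (rule Lim_transform_eventually)
  let ?c = "\<lambda>N \<phi>. indicator {0<..real N * pi} \<phi> *
      connection_prob \<zeta> \<beta> (disc_radius \<zeta> N) (disc_radius \<zeta> N - t, 0) (disc_radius \<zeta> N - s, \<phi> / real N)"
  let ?l = "\<lambda>\<phi>. indicator {0<..} \<phi> / (1 + (exp (- \<zeta> * (t + s) / 2) / 2 * \<phi>) powr \<beta>)"
  let ?w = "\<lambda>\<phi>. indicator {0<..} \<phi> / (1 + (exp (- \<zeta> * (t + s) / 2) / (2 * pi) * \<phi>) powr \<beta>)"
  have "(\<lambda>N. integral\<^sup>L lborel (?c N)) \<longlonglongrightarrow> integral\<^sup>L lborel ?l"
  proof (rule integral_dominated_convergence_eventually)
    show "integrable lborel ?w"
      using params by (intro integrable.intros[OF has_bochner_integral_inverse_one_plus_powr_scaled]) auto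
    have "(\<lambda>N. ?c N \<phi>) \<longlonglongrightarrow> ?l \<phi>" for \<phi>
    proof (cases "\<phi> > 0")
      case True
      have "filterlim (\<lambda>N. pi * real N) at_top sequentially"
        by (intro filterlim_tendsto_pos_mult_at_top[OF tendsto_const] filterlim_real_sequentially) auto
      then have "\<forall>\<^sub>F N in sequentially. \<phi> \<le> pi * real N"
        unfolding filterlim_at_top by blast
      then have "\<forall>\<^sub>F N in sequentially. connection_prob \<zeta> \<beta> (disc_radius \<zeta> N) (disc_radius \<zeta> N - t, 0)
          (disc_radius \<zeta> N - s, \<phi> / real N) = ?c N \<phi>"
        by eventually_elim (use True in \<open>auto simp: mult.commute\<close>)
      moreover have "(\<lambda>N. connection_prob \<zeta> \<beta> (disc_radius \<zeta> N) (disc_radius \<zeta> N - t, 0)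
          (disc_radius \<zeta> N - s, \<phi> / real N)) \<longlonglongrightarrow> ?l \<phi>"
        using tendsto_connection_prob[of \<zeta> \<beta> \<phi> t s] True params by simp
      ultimately show ?thesis
        by (rule Lim_transform_eventually[rotated])
    qed auto
    then show "AE \<phi> in lborel. (\<lambda>N. ?c N \<phi>) \<longlonglongrightarrow> ?l \<phi>"
      by simp
    have "\<forall>\<^sub>F N in sequentially. max t s \<le> disc_radius \<zeta> N"
      using filterlim_disc_radius[of \<zeta>] params unfolding filterlim_at_top by blast
    then show "\<forall>\<^sub>F N in sequentially. \<forall>\<phi>. \<bar>?c N \<phi>\<bar> \<le> ?w \<phi>"
      using eventually_gt_at_top[of 0]
    proof eventually_elim
      case (elim N)
      then show ?case
        using scaled_connection_prob_le[of N t s] by (simp add: connection_prob_nonneg)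
    qed
  qed auto
  moreover have "integral\<^sup>L lborel ?l = pi / (\<beta> * sin (pi / \<beta>)) / (exp (- \<zeta> * (t + s) / 2) / 2)"
    using params by (intro has_bochner_integral_integral_eq has_bochner_integral_inverse_one_plus_powr_scaled) auto
  ultimately have "(\<lambda>N. integral\<^sup>L lborel (?c N) / pi) \<longlonglongrightarrow> pi / (\<beta> * sin (pi / \<beta>)) / (exp (- \<zeta> * (t + s) / 2) / 2) / pi"
    by (intro tendsto_intros) auto
  also have "pi / (\<beta> * sin (pi / \<beta>)) / (exp (- \<zeta> * (t + s) / 2) / 2) / pi = 2 / (\<beta> * sin (pi / \<beta>)) * exp (\<zeta> * (t + s) / 2)"
    unfolding exp_neg_half by simp
  finally show "(\<lambda>N. integral\<^sup>L lborel (?c N) / pi) \<longlonglongrightarrow> 2 / (\<beta> * sin (pi / \<beta>)) * exp (\<zeta> * (t + s) / 2)" .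
  show "\<forall>\<^sub>F N in sequentially. integral\<^sup>L lborel (?c N) / pi =
      real N * angular_connection_prob \<zeta> \<beta> (disc_radius \<zeta> N) (disc_radius \<zeta> N - t) (disc_radius \<zeta> N - s)"
    using eventually_gt_at_top[of 0] by eventually_elim (simp add: mult_angular_connection_prob_eq)
qed

text \<open>In the depth coordinate \<open>t\<close>, cancelling
  \<open>exp (\<alpha> * R) / 2\<close> from numerator and denominator leaves \<open>R\<close> only
  in the range of \<open>t\<close> and in the vanishing quantity
  \<open>exp (- \<alpha> * R)\<close>. Limit and uniform bound can both be read off.\<close>

lemma radial_density_eq:
  assumes "R > 0"
  shows "radial_density \<alpha> R (R - t) = (if 0 \<le> t \<and> t \<le> R
    then \<alpha> * (exp (- \<alpha> * t) - exp (\<alpha> * t) * (exp (- \<alpha> * R))\<^sup>2) / (1 - exp (- \<alpha> * R))\<^sup>2 else 0)"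
proof -
  define x where "x = exp (\<alpha> * R)"
  have x: "x > 1" "exp (- \<alpha> * R) = 1 / x"
    using params assms by (auto simp: x_def exp_minus field_simps)
  define y where "y = exp (\<alpha> * t)"
  have y: "y > 0" "exp (- \<alpha> * t) = 1 / y"
    by (auto simp: y_def exp_minus field_simps)
  have "sinh (\<alpha> * (R - t)) = (x / y - y / x) / 2"
    by (simp add: sinh_field_def x_def y_def right_diff_distrib exp_diff)
  also have "\<dots> = (1 / y - y * (1 / x)\<^sup>2) * (x / 2)"
    using x y by (simp add: field_simps power2_eq_square)
  finally have 1: "sinh (\<alpha> * (R - t)) = (1 / y - y * (1 / x)\<^sup>2) * (x / 2)" .
  have "cosh (\<alpha> * R) - 1 = (x + 1 / x) / 2 - 1"
    by (simp add: cosh_field_def x_def exp_minus field_simps)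
  also have "\<dots> = (1 - 1 / x)\<^sup>2 * (x / 2)"
    using x by (simp add: field_simps power2_eq_square)
  finally have 2: "cosh (\<alpha> * R) - 1 = (1 - 1 / x)\<^sup>2 * (x / 2)" .
  have "\<alpha> * sinh (\<alpha> * (R - t)) / (cosh (\<alpha> * R) - 1)
      = \<alpha> * (1 / y - y * (1 / x)\<^sup>2) * (x / 2) / ((1 - 1 / x)\<^sup>2 * (x / 2))"
    unfolding 1 2 by (simp only: mult.assoc)
  also have "\<dots> = \<alpha> * (1 / y - y * (1 / x)\<^sup>2) / (1 - 1 / x)\<^sup>2"
    using x by (subst mult_divide_mult_cancel_right) auto
  finally show ?thesis
    unfolding x(2) y(2) y_def[symmetric] by (auto simp: radial_density_def)
qed

lemma radial_density_nonneg: "0 \<le> radial_density \<alpha> R r"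
  using params cosh_real_ge_1[of "\<alpha> * R"] by (auto simp: radial_density_def)

lemma tendsto_exp_disc_radius: "(\<lambda>N. exp (- \<alpha> * disc_radius \<zeta> N)) \<longlonglongrightarrow> 0"
proof -
  have "filterlim (\<lambda>N. \<alpha> * disc_radius \<zeta> N) at_top sequentially"
    using params by (intro filterlim_tendsto_pos_mult_at_top[OF tendsto_const] filterlim_disc_radius) auto
  then have "filterlim (\<lambda>N. - (\<alpha> * disc_radius \<zeta> N)) at_bot sequentially"
    by (simp add: filterlim_uminus_at_bot)
  from filterlim_compose[OF exp_at_bot this] show ?thesis
    by simp
qed

lemma eventually_radial_density_le:
  "\<forall>\<^sub>F N in sequentially. \<forall>t. radial_density \<alpha> (disc_radius \<zeta> N) (disc_radius \<zeta> N - t)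
     \<le> 4 * \<alpha> * (indicator {0..} t * exp (- \<alpha> * t))"
proof -
  have "\<forall>\<^sub>F N in sequentially. exp (- \<alpha> * disc_radius \<zeta> N) < 1 / 2"
    by (rule order_tendstoD(2)[OF tendsto_exp_disc_radius]) simp
  moreover have "\<forall>\<^sub>F N in sequentially. disc_radius \<zeta> N \<ge> 1"
    using filterlim_disc_radius[of \<zeta>] params unfolding filterlim_at_top by blast
  ultimately show ?thesis
  proof eventually_elim
    case (elim N)
    define x where "x = exp (- \<alpha> * disc_radius \<zeta> N)"
    \<comment> \<open>The factor 4 of the bound: once \<open>exp (- \<alpha> * R) < 1 / 2\<close>,
      the squared denominator is at least \<open>1 / 4\<close>.\<close>
    have "(1 / 2)\<^sup>2 \<le> (1 - x)\<^sup>2"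
      using elim by (intro power_mono) (auto simp: x_def)
    then have x: "1 / 4 \<le> (1 - x)\<^sup>2"
      by (simp add: power_divide)
    have "\<alpha> * (exp (- \<alpha> * t) - exp (\<alpha> * t) * x\<^sup>2) / (1 - x)\<^sup>2 \<le> 4 * \<alpha> * exp (- \<alpha> * t)" for t
    proof -
      have "\<alpha> * (exp (- \<alpha> * t) - exp (\<alpha> * t) * x\<^sup>2) / (1 - x)\<^sup>2 \<le> \<alpha> * exp (- \<alpha> * t) / (1 / 4)"
        using x params by (intro frac_le) auto
      then show ?thesis
        by (simp only: divide_divide_eq_right)
    qed
    moreover have "disc_radius \<zeta> N > 0"
      using elim by simp
    ultimately show ?case
      using params by (auto simp only: radial_density_eq x_def[symmetric] indicator_def split: if_splits) auto
  qed
qed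

lemma tendsto_radial_density:
  "(\<lambda>N. radial_density \<alpha> (disc_radius \<zeta> N) (disc_radius \<zeta> N - t)) \<longlonglongrightarrow> exponential_density \<alpha> t"
proof (rule Lim_transform_eventually)
  let ?x = "\<lambda>N. exp (- \<alpha> * disc_radius \<zeta> N)"
  let ?f = "\<lambda>N. if 0 \<le> t then \<alpha> * (exp (- \<alpha> * t) - exp (\<alpha> * t) * (?x N)\<^sup>2) / (1 - ?x N)\<^sup>2 else 0"
  have "(\<lambda>N. \<alpha> * (exp (- \<alpha> * t) - exp (\<alpha> * t) * (?x N)\<^sup>2) / (1 - ?x N)\<^sup>2)
     \<longlonglongrightarrow> \<alpha> * (exp (- \<alpha> * t) - exp (\<alpha> * t) * 0\<^sup>2) / (1 - 0)\<^sup>2"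
    by (intro tendsto_intros tendsto_exp_disc_radius) auto
  then show "?f \<longlonglongrightarrow> exponential_density \<alpha> t"
    by (cases "t \<ge> 0") (simp_all add: exponential_density_def mult.commute)
  have "\<forall>\<^sub>F N in sequentially. disc_radius \<zeta> N \<ge> max 1 t"
    using filterlim_disc_radius[of \<zeta>] params unfolding filterlim_at_top by blast
  then show "\<forall>\<^sub>F N in sequentially. ?f N = radial_density \<alpha> (disc_radius \<zeta> N) (disc_radius \<zeta> N - t)"
    by eventually_elim (auto simp: radial_density_eq)
qed

lemma radial_connection_prob_eq:
  "radial_connection_prob \<zeta> \<alpha> \<beta> R r =
    (\<integral>s. radial_density \<alpha> R (R - s) * angular_connection_prob \<zeta> \<beta> R r (R - s) \<partial>lborel)"
  unfolding radial_connection_prob_def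
  by (subst lborel_integral_real_affine[where c = "- 1" and t = R]) auto

lemma radial_connection_prob_nonneg: "0 \<le> radial_connection_prob \<zeta> \<alpha> \<beta> R r"
  unfolding radial_connection_prob_def
  by (intro Bochner_Integration.integral_nonneg) (auto simp: radial_density_nonneg angular_connection_prob_nonneg)

text \<open>The dominating function \<open>exp (- \<alpha> s) * exp (\<zeta> s / 2)\<close> is integrable because \<open>\<zeta> < 2 \<alpha>\<close>.\<close>

lemma eventually_scaled_density_le:
  "\<forall>\<^sub>F N in sequentially. \<forall>t s. t \<le> disc_radius \<zeta> N \<longrightarrow>
     real N * (radial_density \<alpha> (disc_radius \<zeta> N) (disc_radius \<zeta> N - s) *
       angular_connection_prob \<zeta> \<beta> (disc_radius \<zeta> N) (disc_radius \<zeta> N - t) (disc_radius \<zeta> N - s))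
     \<le> 8 * \<alpha> * (pi / (\<beta> * sin (pi / \<beta>))) * exp (\<zeta> * t / 2) * (indicator {0..} s * exp (- (\<alpha> - \<zeta> / 2) * s))"
  using eventually_radial_density_le eventually_gt_at_top[of 0]
proof eventually_elim
  case (elim N)
  show ?case
  proof (intro allI impI)
    fix t s assume t: "t \<le> disc_radius \<zeta> N"
    have pos: "0 < sin (pi / \<beta>)"
      using params by (intro sin_gt_zero) (auto simp: field_simps)
    show "real N * (radial_density \<alpha> (disc_radius \<zeta> N) (disc_radius \<zeta> N - s) *
       angular_connection_prob \<zeta> \<beta> (disc_radius \<zeta> N) (disc_radius \<zeta> N - t) (disc_radius \<zeta> N - s))
     \<le> 8 * \<alpha> * (pi / (\<beta> * sin (pi / \<beta>))) * exp (\<zeta> * t / 2) * (indicator {0..} s * exp (- (\<alpha> - \<zeta> / 2) * s))"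
    proof (cases "0 \<le> s \<and> s \<le> disc_radius \<zeta> N")
      case True
      have "radial_density \<alpha> (disc_radius \<zeta> N) (disc_radius \<zeta> N - s) * (real N *
         angular_connection_prob \<zeta> \<beta> (disc_radius \<zeta> N) (disc_radius \<zeta> N - t) (disc_radius \<zeta> N - s))
       \<le> 4 * \<alpha> * (indicator {0..} s * exp (- \<alpha> * s)) * (2 * (pi / (\<beta> * sin (pi / \<beta>))) * exp (\<zeta> * (t + s) / 2))"
      proof (rule mult_mono)
        show "real N * angular_connection_prob \<zeta> \<beta> (disc_radius \<zeta> N) (disc_radius \<zeta> N - t) (disc_radius \<zeta> N - s)
            \<le> 2 * (pi / (\<beta> * sin (pi / \<beta>))) * exp (\<zeta> * (t + s) / 2)"
          using elim True t by (intro mult_angular_connection_prob_le) auto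
      qed (use elim params in \<open>auto simp: angular_connection_prob_nonneg\<close>)
      also have "\<dots> = 8 * \<alpha> * (pi / (\<beta> * sin (pi / \<beta>))) *
          (indicator {0..} s * (exp (- \<alpha> * s) * exp (\<zeta> * (t + s) / 2)))"
        by simp
      also have "exp (- \<alpha> * s) * exp (\<zeta> * (t + s) / 2) = exp (\<zeta> * t / 2) * exp (- (\<alpha> - \<zeta> / 2) * s)"
        unfolding exp_add[symmetric] by (simp add: algebra_simps add_divide_distrib)
      finally show ?thesis
        by (simp add: mult_ac)
    next
      case False
      then have "radial_density \<alpha> (disc_radius \<zeta> N) (disc_radius \<zeta> N - s) = 0"
        by (auto simp: radial_density_def)
      then show ?thesis
        using params pos by simp
    qed
  qed
qed

lemma integrable_scaled_density_bound:
  "integrable lborel (\<lambda>s. c * (indicator {0..} s * exp (- (\<alpha> - \<zeta> / 2) * s)))"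
  using params by (intro integrable_mult_right integrable.intros[OF has_bochner_integral_exp_half_line]) auto

text \<open>\<open>C\<close> depends neither on \<open>N\<close> nor on the depth. Integrating the
  preceding bound over \<open>s\<close> gives it, and it serves to dominate
  \<open>N * p\<^sup>2\<close> in \<open>tendsto_mult_integral_square\<close>.\<close>

lemma eventually_mult_radial_connection_prob_le:
  obtains C where "\<forall>\<^sub>F N in sequentially. \<forall>t. t \<le> disc_radius \<zeta> N \<longrightarrow>
     real N * radial_connection_prob \<zeta> \<alpha> \<beta> (disc_radius \<zeta> N) (disc_radius \<zeta> N - t) \<le> C * exp (\<zeta> * t / 2)"
proof -
  define D where "D = 8 * \<alpha> * (pi / (\<beta> * sin (pi / \<beta>)))"
  define C where "C = D * (1 / (\<alpha> - \<zeta> / 2))"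
  have "\<forall>\<^sub>F N in sequentially. \<forall>t. t \<le> disc_radius \<zeta> N \<longrightarrow>
     real N * radial_connection_prob \<zeta> \<alpha> \<beta> (disc_radius \<zeta> N) (disc_radius \<zeta> N - t) \<le> C * exp (\<zeta> * t / 2)"
    using eventually_scaled_density_le
  proof eventually_elim
    case (elim N)
    show ?case
    proof (intro allI impI)
      fix t assume t: "t \<le> disc_radius \<zeta> N"
      let ?f = "\<lambda>s. real N * (radial_density \<alpha> (disc_radius \<zeta> N) (disc_radius \<zeta> N - s) *
         angular_connection_prob \<zeta> \<beta> (disc_radius \<zeta> N) (disc_radius \<zeta> N - t) (disc_radius \<zeta> N - s))"
      let ?w = "\<lambda>s. D * exp (\<zeta> * t / 2) * (indicator {0..} s * exp (- (\<alpha> - \<zeta> / 2) * s))"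
      have le: "?f s \<le> ?w s" for s
        using elim t by (simp add: D_def)
      have nonneg: "0 \<le> ?f s" for s
        by (simp add: radial_density_nonneg angular_connection_prob_nonneg)
      have "integrable lborel ?f"
        using integrable_scaled_density_bound[of "D * exp (\<zeta> * t / 2)"]
        by (rule Bochner_Integration.integrable_bound)
          (use nonneg le in \<open>auto intro!: AE_I2 intro: order_trans[OF _ abs_ge_self]\<close>)
      then have "integral\<^sup>L lborel ?f \<le> integral\<^sup>L lborel ?w"
        using le by (intro integral_mono integrable_scaled_density_bound)
      also have "\<dots> = C * exp (\<zeta> * t / 2)"
        using params has_bochner_integral_integral_eq[OF has_bochner_integral_exp_half_line[of "\<alpha> - \<zeta> / 2"]]
        by (subst integral_mult_right_zero) (simp add: C_def)
      finally show "real N * radial_connection_prob \<zeta> \<alpha> \<beta> (disc_radius \<zeta> N) (disc_radius \<zeta> N - t) \<le> C * exp (\<zeta> * t / 2)"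
        by (simp add: radial_connection_prob_eq)
    qed
  qed
  then show ?thesis
    by (rule that)
qed

lemma tendsto_mult_radial_connection_prob:
  "(\<lambda>N. real N * radial_connection_prob \<zeta> \<alpha> \<beta> (disc_radius \<zeta> N) (disc_radius \<zeta> N - t))
    \<longlonglongrightarrow> mixing_constant \<zeta> \<alpha> \<beta> * exp (\<zeta> * t / 2)"
proof -
  let ?f = "\<lambda>N s. real N * (radial_density \<alpha> (disc_radius \<zeta> N) (disc_radius \<zeta> N - s) *
     angular_connection_prob \<zeta> \<beta> (disc_radius \<zeta> N) (disc_radius \<zeta> N - t) (disc_radius \<zeta> N - s))"
  let ?l = "\<lambda>s. exponential_density \<alpha> s * (2 / (\<beta> * sin (pi / \<beta>)) * exp (\<zeta> * (t + s) / 2))"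
  let ?w = "\<lambda>s. 8 * \<alpha> * (pi / (\<beta> * sin (pi / \<beta>))) * exp (\<zeta> * t / 2) * (indicator {0..} s * exp (- (\<alpha> - \<zeta> / 2) * s))"
  have "(\<lambda>N. integral\<^sup>L lborel (?f N)) \<longlonglongrightarrow> integral\<^sup>L lborel ?l"
  proof (rule integral_dominated_convergence_eventually)
    show "integrable lborel ?w"
      by (rule integrable_scaled_density_bound)
    have "(\<lambda>N. radial_density \<alpha> (disc_radius \<zeta> N) (disc_radius \<zeta> N - s) * (real N * 
     angular_connection_prob \<zeta> \<beta> (disc_radius \<zeta> N) (disc_radius \<zeta> N - t) (disc_radius \<zeta> N - s))) \<longlonglongrightarrow> ?l s" for s
      by (intro tendsto_mult tendsto_radial_density tendsto_mult_angular_connection_prob)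
    then show "AE s in lborel. (\<lambda>N. ?f N s) \<longlonglongrightarrow> ?l s"
      by (simp add: mult_ac)
    have "\<forall>\<^sub>F N in sequentially. t \<le> disc_radius \<zeta> N"
      using filterlim_disc_radius[of \<zeta>] params unfolding filterlim_at_top by blast
    then show "\<forall>\<^sub>F N in sequentially. \<forall>s. \<bar>?f N s\<bar> \<le> ?w s"
      using eventually_scaled_density_le
      by eventually_elim (simp add: radial_density_nonneg angular_connection_prob_nonneg)
  qed auto
  moreover have "integral\<^sup>L lborel ?l = mixing_constant \<zeta> \<alpha> \<beta> * exp (\<zeta> * t / 2)"
  proof -
    have l: "?l s = \<alpha> * (2 / (\<beta> * sin (pi / \<beta>))) * exp (\<zeta> * t / 2) * (indicator {0..} s * exp (- (\<alpha> - \<zeta> / 2) * s))" for s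
    proof -
      have "exp (- s * \<alpha>) * exp (\<zeta> * (t + s) / 2) = exp (\<zeta> * t / 2) * exp (- (\<alpha> - \<zeta> / 2) * s)"
        unfolding exp_add[symmetric] by (simp add: algebra_simps add_divide_distrib)
      then show ?thesis
        by (auto simp: exponential_density_def)
    qed
    have "integral\<^sup>L lborel ?l = \<alpha> * (2 / (\<beta> * sin (pi / \<beta>))) * exp (\<zeta> * t / 2) * (1 / (\<alpha> - \<zeta> / 2))"
      unfolding l using params has_bochner_integral_integral_eq[OF has_bochner_integral_exp_half_line[of "\<alpha> - \<zeta> / 2"]]
      by (subst integral_mult_right_zero) simp
    also have "1 / (\<alpha> - \<zeta> / 2) = 2 / (2 * \<alpha> - \<zeta>)"
      using params by (simp add: field_simps)
    finally show ?thesis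
      by (simp add: mixing_constant_def mult_ac)
  qed
  ultimately show ?thesis
    by (simp add: radial_connection_prob_eq)
qed

end

subsection \<open>Rotation invariance\<close>

text \<open>A shift by a multiple of \<open>2 * pi\<close> moves the start of the window to some
  \<open>b\<close> in \<open>[0, 2 * pi)\<close>; the part beyond \<open>2 * pi\<close> is then cut
  off and moved back to \<open>(0, b]\<close>. With nonnegative integrals the pieces add up without
  integrability conditions.\<close>

lemma nn_integral_cos_period:
  fixes G :: "real \<Rightarrow> ennreal"
  assumes [measurable]: "G \<in> borel_measurable borel"
  shows "(\<integral>\<^sup>+x. indicator {a<..a + 2 * pi} x * G (cos x) \<partial>lborel)
       = (\<integral>\<^sup>+x. indicator {0<..2 * pi} x * G (cos x) \<partial>lborel)"
proof -
  define k where "k = \<lfloor>a / (2 * pi)\<rfloor>"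
  define b where "b = a - 2 * pi * of_int k"
  have "of_int k \<le> a / (2 * pi)" "a / (2 * pi) < of_int k + 1"
    unfolding k_def by linarith+
  then have b: "0 \<le> b" "b < 2 * pi"
    by (auto simp: b_def field_simps)
  have per: "cos (2 * pi * of_int j + x) = cos x" for j and x :: real
    using cos_int_2pin[of j] sin_int_2pin[of j] by (simp add: cos_add)
  have "(\<integral>\<^sup>+x. indicator {a<..a + 2 * pi} x * G (cos x) \<partial>lborel)
      = (\<integral>\<^sup>+x. indicator {b<..b + 2 * pi} x * G (cos x) \<partial>lborel)"
  proof -
    have "indicator {a<..a + 2 * pi} (2 * pi * of_int k + x) = (indicator {b<..b + 2 * pi} x :: ennreal)" for x
      by (auto simp: b_def indicator_def)
    then show ?thesis
      by (subst nn_integral_real_affine[where c = 1 and t = "2 * pi * of_int k"]) (auto simp: per)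
  qed
  also have "\<dots> = (\<integral>\<^sup>+x. indicator {b<..2 * pi} x * G (cos x) + indicator {2 * pi<..b + 2 * pi} x * G (cos x) \<partial>lborel)"
    using b by (intro nn_integral_cong) (auto simp: indicator_def)
  also have "\<dots> = (\<integral>\<^sup>+x. indicator {b<..2 * pi} x * G (cos x) \<partial>lborel)
      + (\<integral>\<^sup>+x. indicator {2 * pi<..b + 2 * pi} x * G (cos x) \<partial>lborel)"
    by (intro nn_integral_add) auto
  also have "(\<integral>\<^sup>+x. indicator {2 * pi<..b + 2 * pi} x * G (cos x) \<partial>lborel)
      = (\<integral>\<^sup>+x. indicator {0<..b} x * G (cos x) \<partial>lborel)"
    by (subst nn_integral_real_affine[where c = 1 and t = "2 * pi"])
      (use per[of 1] in \<open>auto simp: indicator_def intro!: nn_integral_cong\<close>)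
  also have "(\<integral>\<^sup>+x. indicator {b<..2 * pi} x * G (cos x) \<partial>lborel) + (\<integral>\<^sup>+x. indicator {0<..b} x * G (cos x) \<partial>lborel)
      = (\<integral>\<^sup>+x. indicator {b<..2 * pi} x * G (cos x) + indicator {0<..b} x * G (cos x) \<partial>lborel)"
    by (intro nn_integral_add[symmetric]) auto
  also have "\<dots> = (\<integral>\<^sup>+x. indicator {0<..2 * pi} x * G (cos x) \<partial>lborel)"
    using b by (intro nn_integral_cong) (auto simp: indicator_def)
  finally show ?thesis .
qed

lemma nn_integral_cos_half_period:
  fixes G :: "real \<Rightarrow> ennreal"
  assumes [measurable]: "G \<in> borel_measurable borel"
  shows "(\<integral>\<^sup>+x. indicator {0<..2 * pi} x * G (cos x) \<partial>lborel)
       = 2 * (\<integral>\<^sup>+x. indicator {0<..pi} x * G (cos x) \<partial>lborel)"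
proof -
  have "(\<integral>\<^sup>+x. indicator {pi<..2 * pi} x * G (cos x) \<partial>lborel)
      = (\<integral>\<^sup>+x. indicator {0..<pi} x * G (cos x) \<partial>lborel)"
    by (subst nn_integral_real_affine[where c = "- 1" and t = "2 * pi"])
      (auto simp: indicator_def cos_diff intro!: nn_integral_cong)
  \<comment> \<open>The reflection \<open>x \<mapsto> 2 * pi - x\<close> has exchanged the open and
    the closed end of the interval, a difference of two points.\<close>
  also have "\<dots> = (\<integral>\<^sup>+x. indicator {0<..pi} x * G (cos x) \<partial>lborel)"
  proof (rule nn_integral_cong_AE)
    have "AE x in lborel. x \<noteq> 0 \<and> x \<noteq> pi"
      by (intro AE_conjI AE_lborel_singleton)
    then show "AE x in lborel. indicator {0..<pi} x * G (cos x) = indicator {0<..pi} x * G (cos x)"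
      by eventually_elim (auto simp: indicator_def)
  qed
  finally have half: "(\<integral>\<^sup>+x. indicator {pi<..2 * pi} x * G (cos x) \<partial>lborel)
      = (\<integral>\<^sup>+x. indicator {0<..pi} x * G (cos x) \<partial>lborel)" .
  have "(\<integral>\<^sup>+x. indicator {0<..2 * pi} x * G (cos x) \<partial>lborel)
      = (\<integral>\<^sup>+x. indicator {0<..pi} x * G (cos x) + indicator {pi<..2 * pi} x * G (cos x) \<partial>lborel)"
    by (intro nn_integral_cong) (auto simp: indicator_def)
  also have "\<dots> = (\<integral>\<^sup>+x. indicator {0<..pi} x * G (cos x) \<partial>lborel) + (\<integral>\<^sup>+x. indicator {pi<..2 * pi} x * G (cos x) \<partial>lborel)"
    by (intro nn_integral_add) auto
  finally show ?thesis
    unfolding half by (simp only: mult_2)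
qed

lemma integral_cos_diff:
  fixes g :: "real \<Rightarrow> real"
  assumes [measurable]: "g \<in> borel_measurable borel" and "\<And>x. g x \<ge> 0"
  shows "(\<integral>x. indicator {0<..2 * pi} x * g (cos (a - x)) \<partial>lborel)
       = 2 * (\<integral>x. indicator {0<..pi} x * g (cos x) \<partial>lborel)"
proof -
  define G where "G = (\<lambda>x. ennreal (g x))"
  have [measurable]: "G \<in> borel_measurable borel"
    unfolding G_def by measurable
  have ind: "ennreal (indicator A x * g y) = indicator A x * G y" for A and x y :: real
    by (auto simp: G_def indicator_def)
  have "(\<integral>\<^sup>+x. indicator {0<..2 * pi} x * G (cos (a - x)) \<partial>lborel)
      = (\<integral>\<^sup>+x. indicator {- a<..- a + 2 * pi} x * G (cos x) \<partial>lborel)"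
    by (subst nn_integral_real_affine[where c = 1 and t = a])
      (auto simp: indicator_def intro!: nn_integral_cong)
  also have "\<dots> = 2 * (\<integral>\<^sup>+x. indicator {0<..pi} x * G (cos x) \<partial>lborel)"
    by (simp only: nn_integral_cos_period[OF \<open>G \<in> _\<close>] nn_integral_cos_half_period[OF \<open>G \<in> _\<close>])
  finally show ?thesis
    using assms by (simp add: integral_eq_nn_integral ind enn2real_mult)
qed

lemma connection_prob_cos_cong:
  assumes "cos (a - b) = cos (c - d)"
  shows "connection_prob \<zeta> \<beta> R (r, a) (s, b) = connection_prob \<zeta> \<beta> R (r, c) (s, d)"
  using assms by (simp add: connection_prob_def hyp_dist_def cos_relative_angle)

lemma connection_prob_commute: "connection_prob \<zeta> \<beta> R u v = connection_prob \<zeta> \<beta> R v u"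
proof -
  have "relative_angle (snd u) (snd v) = relative_angle (snd v) (snd u)"
    by (simp add: relative_angle_def abs_minus_commute)
  then have "hyp_dist \<zeta> u v = hyp_dist \<zeta> v u"
    by (simp add: hyp_dist_def mult.commute)
  then show ?thesis
    by (simp add: connection_prob_def)
qed

text \<open>Rotation invariance: for fixed radii the connection probability is a function
  \<open>g\<close> of the cosine of the angle difference, so neither \<theta> nor the sign of the
  difference affects the average over a full turn.\<close>

lemma integral_uniform_angle:
  "(\<integral>\<psi>. connection_prob \<zeta> \<beta> R (r, \<theta>) (s, \<psi>) \<partial>uniform_measure lborel {0<..2 * pi})
     = angular_connection_prob \<zeta> \<beta> R r s"
proof -
  \<comment> \<open>\<open>arccos\<close> recovers a representative angle from its cosine. Clamping
    the argument to \<open>[-1, 1]\<close> makes this continuous on the whole line, hence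
    \<open>g\<close> measurable, and changes nothing at actual cosines.\<close>
  define g where "g = (\<lambda>x. connection_prob \<zeta> \<beta> R (r, 0) (s, arccos (max (- 1) (min 1 x))))"
  have [measurable]: "g \<in> borel_measurable borel"
  proof -
    have "continuous_on UNIV (\<lambda>x::real. arccos (max (- 1) (min 1 x)))"
      by (intro continuous_intros) auto
    then have [measurable]: "(\<lambda>x::real. arccos (max (- 1) (min 1 x))) \<in> borel_measurable borel"
      by (rule borel_measurable_continuous_onI)
    show ?thesis
      unfolding g_def by measurable
  qed
  have g: "connection_prob \<zeta> \<beta> R (r, a) (s, b) = g (cos (a - b))" for a b
  proof -
    have "cos (0 - arccos (cos (a - b))) = cos (a - b)"
      by (simp add: cos_arccos)
    then show ?thesis
      unfolding g_def by (intro connection_prob_cos_cong) (simp add: min_absorb2 max_absorb2)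
  qed
  have "(\<integral>\<psi>. connection_prob \<zeta> \<beta> R (r, \<theta>) (s, \<psi>) \<partial>uniform_measure lborel {0<..2 * pi})
      = (\<integral>\<psi>. indicator {0<..2 * pi} \<psi> * g (cos (\<theta> - \<psi>)) \<partial>lborel) / (2 * pi)"
  proof -
    have "uniform_measure lborel {0<..2 * pi} = density lborel (\<lambda>\<psi>. ennreal (indicator {0<..2 * pi} \<psi> / (2 * pi)))"
      unfolding uniform_measure_def using divide_ennreal[of 1 "2 * pi"]
      by (intro density_cong) (auto simp: indicator_def)
    then show ?thesis
      unfolding g by (simp add: integral_density)
  qed
  also have "\<dots> = (\<integral>\<psi>. indicator {0<..pi} \<psi> * g (cos \<psi>) \<partial>lborel) / pi"
  proof -
    have "0 \<le> g x" for x
      by (simp add: g_def connection_prob_nonneg)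
    then show ?thesis
      by (subst integral_cos_diff) auto
  qed
  finally show ?thesis
    by (simp add: angular_connection_prob_def g)
qed

text \<open>Fubini with the angle inside: by rotation invariance the inner integral no longer
  depends on the angle of \<open>x\<close>, so only its radius survives.\<close>

lemma integral_connection_prob:
  assumes "\<alpha> > 0" "R > 0"
  shows "(\<integral>y. connection_prob \<zeta> \<beta> R x y \<partial>point_distribution \<alpha> R) = radial_connection_prob \<zeta> \<alpha> \<beta> R (fst x)"
proof -
  obtain r \<theta> where x: "x = (r, \<theta>)"
    by (cases x)
  interpret A: prob_space "density lborel (\<lambda>r. ennreal (radial_density \<alpha> R r))"
    by (rule prob_space_radial[OF assms])
  interpret B: prob_space "uniform_measure lborel {0<..2 * pi}"
    by (rule prob_space_uniform_measure) auto
  interpret pair_prob_space "density lborel (\<lambda>r. ennreal (radial_density \<alpha> R r))"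
      "uniform_measure lborel {0<..2 * pi}" ..
  have nonneg: "0 \<le> radial_density \<alpha> R r" for r
    using assms cosh_real_ge_1[of "\<alpha> * R"] by (auto simp: radial_density_def)
  have "integrable (density lborel (\<lambda>r. ennreal (radial_density \<alpha> R r)) \<Otimes>\<^sub>M uniform_measure lborel {0<..2 * pi})
      (\<lambda>y. connection_prob \<zeta> \<beta> R (r, \<theta>) (fst y, snd y))"
    by (rule P.integrable_const_bound[of _ 1]) (auto simp: connection_prob_nonneg connection_prob_le_1)
  then have "(\<integral>y. connection_prob \<zeta> \<beta> R (r, \<theta>) (fst y, snd y) \<partial>point_distribution \<alpha> R)
      = (\<integral>s. (\<integral>\<psi>. connection_prob \<zeta> \<beta> R (r, \<theta>) (s, \<psi>) \<partial>uniform_measure lborel {0<..2 * pi})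
           \<partial>density lborel (\<lambda>r. ennreal (radial_density \<alpha> R r)))"
    unfolding point_distribution_def by (subst integral_fst'[symmetric]) auto
  also have "\<dots> = radial_connection_prob \<zeta> \<alpha> \<beta> R r"
    unfolding integral_uniform_angle radial_connection_prob_def
    using nonneg by (subst integral_density) auto
  finally show ?thesis
    by (simp add: x)
qed

lemma integral_point_distribution_radial:
  fixes h :: "real \<Rightarrow> real"
  assumes "\<alpha> > 0" "R > 0" and [measurable]: "h \<in> borel_measurable borel"
  shows "(\<integral>x. h (fst x) \<partial>point_distribution \<alpha> R) = (\<integral>t. radial_density \<alpha> R (R - t) * h (R - t) \<partial>lborel)"
proof -
  interpret A: prob_space "density lborel (\<lambda>r. ennreal (radial_density \<alpha> R r))"
    by (rule prob_space_radial[OF assms(1,2)])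
  interpret B: prob_space "uniform_measure lborel {0<..2 * pi}"
    by (rule prob_space_uniform_measure) auto
  have nonneg: "0 \<le> radial_density \<alpha> R r" for r
    using assms cosh_real_ge_1[of "\<alpha> * R"] by (auto simp: radial_density_def)
  have "(\<integral>x. h (fst x) \<partial>point_distribution \<alpha> R)
      = integral\<^sup>L (distr (point_distribution \<alpha> R) (density lborel (\<lambda>r. ennreal (radial_density \<alpha> R r))) fst) h"
    unfolding point_distribution_def by (subst integral_distr) auto
  also have "distr (point_distribution \<alpha> R) (density lborel (\<lambda>r. ennreal (radial_density \<alpha> R r))) fst
      = density lborel (\<lambda>r. ennreal (radial_density \<alpha> R r))"
    unfolding point_distribution_def by (rule B.distr_pair_fst)
  also have "integral\<^sup>L \<dots> h = (\<integral>r. radial_density \<alpha> R r * h r \<partial>lborel)"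
    using nonneg by (subst integral_density) auto
  also have "\<dots> = (\<integral>t. radial_density \<alpha> R (R - t) * h (R - t) \<partial>lborel)"
    by (subst lborel_integral_real_affine[where c = "- 1" and t = R]) auto
  finally show ?thesis .
qed

subsection \<open>Inhomogeneous random graphs with a general kernel\<close>

text \<open>On \<open>[0, 1]\<close> the powers satisfy
  \<open>\<bar>a ^ n - b ^ n\<bar> \<le> n * \<bar>a - b\<bar>\<close>. The assumption on
  \<open>a - b\<close> is one-sided; if \<open>a \<le> b\<close>, monotonicity and
  \<open>q \<ge> 0\<close> suffice.\<close>

lemma power_le_power_add:
  fixes a b q :: real
  assumes "0 \<le> a" "a \<le> 1" "0 \<le> b" "b \<le> 1" "a - b \<le> q" "0 \<le> q"
  shows "a ^ n \<le> b ^ n + real n * q"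
proof (cases "a \<le> b")
  case True
  then have "a ^ n \<le> b ^ n"
    using assms by (intro power_mono) auto
  then show ?thesis
    using assms by (smt (verit) mult_nonneg_nonneg of_nat_0_le_iff)
next
  case False
  have "\<bar>a ^ n - b ^ n\<bar> \<le> real n * \<bar>a - b\<bar>"
    using norm_power_diff[of a b n] assms by simp
  also have "\<dots> \<le> real n * q"
    using False assms by (intro mult_left_mono) auto
  finally show ?thesis
    by linarith
qed

lemma norm_le_1I: "0 \<le> x \<Longrightarrow> x \<le> 1 \<Longrightarrow> norm (x :: real) \<le> 1"
  by simp

lemma one_minus_bounds:
  fixes y :: real
  assumes "0 \<le> \<sigma>" "\<sigma> \<le> 1" "0 \<le> y" "y \<le> 1"
  shows "0 \<le> 1 - \<sigma> * y" "1 - \<sigma> * y \<le> 1"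
  using assms mult_le_one[of \<sigma> y] by auto

text \<open>The two moment computations use only a symmetric \<open>[0, 1]\<close>-valued kernel on
  a probability space; the geometry enters their results only through integrals of functions of
  \<open>mean_kernel\<close>.\<close>

locale connection_kernel = prob_space M for M :: "'a measure" +
  fixes c :: "'a \<Rightarrow> 'a \<Rightarrow> real"
  assumes kernel_measurable: "(\<lambda>(x, y). c x y) \<in> borel_measurable (M \<Otimes>\<^sub>M M)"
    and kernel_nonneg: "\<And>x y. 0 \<le> c x y"
    and kernel_le_1: "\<And>x y. c x y \<le> 1"
    and kernel_commute: "\<And>x y. c x y = c y x"
begin

definition mean_kernel :: "'a \<Rightarrow> real" where
  "mean_kernel x = (\<integral>y. c x y \<partial>M)"

sublocale product_sigma_finite "\<lambda>_ :: 'i. M"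
  by standard

lemma kernel_measurable' [measurable]:
  assumes [measurable]: "f \<in> N \<rightarrow>\<^sub>M M" "g \<in> N \<rightarrow>\<^sub>M M"
  shows "(\<lambda>x. c (f x) (g x)) \<in> borel_measurable N"
proof -
  have "(\<lambda>x. (f x, g x)) \<in> N \<rightarrow>\<^sub>M M \<Otimes>\<^sub>M M"
    by measurable
  from measurable_compose[OF this kernel_measurable] show ?thesis
    by simp
qed

lemma mean_kernel_measurable [measurable]: "mean_kernel \<in> borel_measurable M"
  unfolding mean_kernel_def[abs_def] by measurable

lemma integrable_kernel: "x \<in> space M \<Longrightarrow> integrable M (c x)"
  by (rule integrable_const_bound[of _ 1]) (auto simp: kernel_nonneg kernel_le_1)

lemma mean_kernel_nonneg: "0 \<le> mean_kernel x"
  unfolding mean_kernel_def by (intro Bochner_Integration.integral_nonneg kernel_nonneg)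

lemma mean_kernel_le_1:
  assumes "x \<in> space M"
  shows "mean_kernel x \<le> 1"
  using integral_mono[OF integrable_kernel[OF assms] integrable_const[of "1 :: real"]]
  by (simp add: mean_kernel_def kernel_le_1 prob_space)

lemma prob_space_PiM_const: "prob_space (PiM I (\<lambda>_. M))"
  by (intro prob_space_PiM prob_space_axioms)

text \<open>Given the positions in \<open>U\<close>, the remaining positions are independent and
  identically distributed, so the product over \<open>w\<close> integrates to a power of a single
  integral. It is applied to sets \<open>U\<close> of one and of two vertices.\<close>

lemma integral_prod_kernel:
  assumes "finite I" "U \<subseteq> I" "0 \<le> \<sigma>" "\<sigma> \<le> 1"
  shows "(\<integral>x. (\<Prod>w\<in>I - U. \<Prod>z\<in>U. 1 - \<sigma> * c (x z) (x w)) \<partial>PiM I (\<lambda>_. M))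
    = (\<integral>x. (\<integral>y. (\<Prod>z\<in>U. 1 - \<sigma> * c (x z) y) \<partial>M) ^ card (I - U) \<partial>PiM U (\<lambda>_. M))"
proof -
  have U: "finite U"
    using assms finite_subset by auto
  have I: "U \<union> (I - U) = I"
    using assms by auto
  interpret P: prob_space "PiM I (\<lambda>_. M)"
    by (rule prob_space_PiM_const)
  have bounds: "0 \<le> 1 - \<sigma> * c x y" "1 - \<sigma> * c x y \<le> 1" for x y
    using one_minus_bounds[of \<sigma> "c x y"] assms kernel_nonneg[of x y] kernel_le_1[of x y] by auto
  have "(\<lambda>x. 1 - \<sigma> * c (x z) (x w)) \<in> borel_measurable (PiM I (\<lambda>_. M))" if "z \<in> I" "w \<in> I" for z w
    using that by measurable
  then have "integrable (PiM I (\<lambda>_. M)) (\<lambda>x. \<Prod>w\<in>I - U. \<Prod>z\<in>U. 1 - \<sigma> * c (x z) (x w))"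
    using assms by (intro P.integrable_const_bound[of _ 1] borel_measurable_prod AE_I2 norm_le_1I)
      (auto intro!: prod_nonneg prod_le_1 bounds)
  then have "(\<integral>x. (\<Prod>w\<in>I - U. \<Prod>z\<in>U. 1 - \<sigma> * c (x z) (x w)) \<partial>PiM I (\<lambda>_. M))
     = (\<integral>x. (\<integral>y. (\<Prod>w\<in>I - U. \<Prod>z\<in>U. 1 - \<sigma> * c (merge U (I - U) (x, y) z) (merge U (I - U) (x, y) w))
          \<partial>PiM (I - U) (\<lambda>_. M)) \<partial>PiM U (\<lambda>_. M))"
    using product_integral_fold[of U "I - U" "\<lambda>x. \<Prod>w\<in>I - U. \<Prod>z\<in>U. 1 - \<sigma> * c (x z) (x w)"] assms U
    unfolding I by simp
  also have "\<dots> = (\<integral>x. (\<integral>y. (\<Prod>w\<in>I - U. \<Prod>z\<in>U. 1 - \<sigma> * c (x z) (y w))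
          \<partial>PiM (I - U) (\<lambda>_. M)) \<partial>PiM U (\<lambda>_. M))"
    by (intro Bochner_Integration.integral_cong prod.cong refl) (auto simp: merge_def)
  also have "\<dots> = (\<integral>x. (\<integral>y. (\<Prod>z\<in>U. 1 - \<sigma> * c (x z) y) \<partial>M) ^ card (I - U) \<partial>PiM U (\<lambda>_. M))"
  proof (rule Bochner_Integration.integral_cong[OF refl])
    fix x assume "x \<in> space (PiM U (\<lambda>_. M))"
    then have [measurable]: "x z \<in> space M" if "z \<in> U" for z
      using that by (auto simp: space_PiM)
    have "integrable M (\<lambda>y. \<Prod>z\<in>U. 1 - \<sigma> * c (x z) y)"
      by (intro integrable_const_bound[of _ 1] borel_measurable_prod AE_I2 norm_le_1I)
        (auto intro!: prod_nonneg prod_le_1 bounds)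
    then show "(\<integral>y. (\<Prod>w\<in>I - U. \<Prod>z\<in>U. 1 - \<sigma> * c (x z) (y w)) \<partial>PiM (I - U) (\<lambda>_. M))
       = (\<integral>y. (\<Prod>z\<in>U. 1 - \<sigma> * c (x z) y) \<partial>M) ^ card (I - U)"
      using product_integral_prod[of "I - U" "\<lambda>_ y. \<Prod>z\<in>U. 1 - \<sigma> * c (x z) y"] assms by simp
  qed
  finally show ?thesis .
qed

lemma integral_prod_kernel_singleton:
  assumes "finite I" "v \<in> I" "0 \<le> \<sigma>" "\<sigma> \<le> 1"
  shows "(\<integral>x. (\<Prod>w\<in>I - {v}. 1 - \<sigma> * c (x v) (x w)) \<partial>PiM I (\<lambda>_. M))
    = (\<integral>x. (1 - \<sigma> * mean_kernel x) ^ (card I - 1) \<partial>M)"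
proof -
  have "(\<integral>x. (\<Prod>w\<in>I - {v}. 1 - \<sigma> * c (x v) (x w)) \<partial>PiM I (\<lambda>_. M))
      = (\<integral>x. (\<integral>y. 1 - \<sigma> * c (x v) y \<partial>M) ^ card (I - {v}) \<partial>PiM {v} (\<lambda>_. M))"
    using integral_prod_kernel[of I "{v}" \<sigma>] assms by simp
  also have "\<dots> = (\<integral>x. (1 - \<sigma> * mean_kernel (x v)) ^ card (I - {v}) \<partial>PiM {v} (\<lambda>_. M))"
  proof (rule Bochner_Integration.integral_cong[OF refl])
    fix x assume "x \<in> space (PiM {v} (\<lambda>_. M))"
    then have "x v \<in> space M"
      by (auto simp: space_PiM)
    then show "(\<integral>y. 1 - \<sigma> * c (x v) y \<partial>M) ^ card (I - {v}) = (1 - \<sigma> * mean_kernel (x v)) ^ card (I - {v})"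
      using integrable_kernel by (simp add: mean_kernel_def prob_space)
  qed
  also have "\<dots> = (\<integral>x. (1 - \<sigma> * mean_kernel x) ^ card (I - {v}) \<partial>M)"
    using product_integral_singleton[of "\<lambda>x. (1 - \<sigma> * mean_kernel x) ^ card (I - {v})" v] by simp
  finally show ?thesis
    using assms by simp
qed

text \<open>Write \<open>m\<close> for \<open>mean_kernel\<close>. One further vertex contributes
  \<open>a = 1 - \<sigma> m(u) - \<sigma> m(v) + \<sigma>\<^sup>2 q\<close>, where \<open>q\<close>
  is its probability of being joined to both \<open>u\<close> and \<open>v\<close>, whereas
  independence would give the product \<open>b\<close>. Since \<open>a - b \<le> q\<close>, the
  \<open>n\<close>-th power of \<open>a\<close> exceeds that of \<open>b\<close> by at most
  \<open>n q\<close>, and \<open>q\<close> averages to the second moment of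
  \<open>m\<close>.\<close>

lemma integral_prod_kernel_pair_le:
  assumes "finite I" "u \<in> I" "v \<in> I" "u \<noteq> v" "0 \<le> \<sigma>" "\<sigma> \<le> 1"
  shows "(\<integral>x. (\<Prod>w\<in>I - {u, v}. (1 - \<sigma> * c (x u) (x w)) * (1 - \<sigma> * c (x v) (x w))) \<partial>PiM I (\<lambda>_. M))
    \<le> (\<integral>x. (1 - \<sigma> * mean_kernel x) ^ (card I - 2) \<partial>M)\<^sup>2 + card I * (\<integral>x. (mean_kernel x)\<^sup>2 \<partial>M)"
proof -
  let ?U = "{u, v}"
  let ?P = "PiM ?U (\<lambda>_. M)"
  define n where "n = card I - 2"
  define q where "q = (\<lambda>x. \<integral>y. c (x u) y * c (x v) y \<partial>M)"
  define a where "a = (\<lambda>x. \<integral>y. (1 - \<sigma> * c (x u) y) * (1 - \<sigma> * c (x v) y) \<partial>M)"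
  define b where "b = (\<lambda>x. (1 - \<sigma> * mean_kernel (x u)) * (1 - \<sigma> * mean_kernel (x v)))"
  interpret P: prob_space ?P
    by (rule prob_space_PiM_const)
  interpret PM: pair_prob_space ?P M ..
  have [measurable]: "(\<lambda>x. x u) \<in> ?P \<rightarrow>\<^sub>M M" "(\<lambda>x. x v) \<in> ?P \<rightarrow>\<^sub>M M"
    by (auto intro: measurable_component_singleton)
  have bounds: "0 \<le> 1 - \<sigma> * c x y" "1 - \<sigma> * c x y \<le> 1" for x y
    using one_minus_bounds[of \<sigma> "c x y"] assms kernel_nonneg[of x y] kernel_le_1[of x y] by auto
  have bounds2: "0 \<le> (1 - \<sigma> * c x y) * (1 - \<sigma> * c x' y)" "(1 - \<sigma> * c x y) * (1 - \<sigma> * c x' y) \<le> 1" for x x' y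
    by (intro mult_nonneg_nonneg mult_le_one bounds)+
  have mbounds: "0 \<le> 1 - \<sigma> * mean_kernel x" "1 - \<sigma> * mean_kernel x \<le> 1" if "x \<in> space M" for x
    using one_minus_bounds[of \<sigma> "mean_kernel x"] assms mean_kernel_nonneg mean_kernel_le_1 that by auto
  have sp: "x u \<in> space M" "x v \<in> space M" if "x \<in> space ?P" for x
    using that by (auto simp: space_PiM)
  have int_q: "integrable M (\<lambda>y. c (x u) y * c (x v) y)" if "x \<in> space ?P" for x
    using sp[OF that]
    by (intro integrable_const_bound[of _ 1] AE_I2 norm_le_1I) (auto simp: kernel_nonneg kernel_le_1 mult_le_one)
  have int_a: "integrable M (\<lambda>y. (1 - \<sigma> * c (x u) y) * (1 - \<sigma> * c (x v) y))" if "x \<in> space ?P" for x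
    using sp[OF that]
    by (intro integrable_const_bound[of _ 1] AE_I2 norm_le_1I) (auto intro!: bounds2)
  have q0: "0 \<le> q x" for x
    unfolding q_def by (intro Bochner_Integration.integral_nonneg) (simp add: kernel_nonneg)
  have q1: "q x \<le> 1" if "x \<in> space ?P" for x
    using integral_mono[OF int_q[OF that] integrable_const[of "1 :: real"]]
    by (simp add: q_def kernel_nonneg kernel_le_1 mult_le_one prob_space)
  have a0: "0 \<le> a x" for x
    unfolding a_def by (intro Bochner_Integration.integral_nonneg bounds2)
  have a1: "a x \<le> 1" if "x \<in> space ?P" for x
    using integral_mono[OF int_a[OF that] integrable_const[of "1 :: real"] bounds2(2)]
    by (simp add: a_def prob_space)
  have b01: "0 \<le> b x" "b x \<le> 1" if "x \<in> space ?P" for x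
    unfolding b_def by (intro mult_nonneg_nonneg mult_le_one mbounds sp[OF that])+
  have ab: "a x - b x \<le> q x" if x: "x \<in> space ?P" for x
  proof -
    have "a x = (\<integral>y. 1 - \<sigma> * c (x u) y - \<sigma> * c (x v) y + \<sigma>\<^sup>2 * (c (x u) y * c (x v) y) \<partial>M)"
      unfolding a_def by (intro Bochner_Integration.integral_cong) (auto simp: algebra_simps power2_eq_square)
    also have "\<dots> = 1 - \<sigma> * mean_kernel (x u) - \<sigma> * mean_kernel (x v) + \<sigma>\<^sup>2 * q x"
      using integrable_kernel[OF sp(1)[OF x]] integrable_kernel[OF sp(2)[OF x]] int_q[OF x]
      by (simp add: mean_kernel_def q_def prob_space)
    finally have "a x - b x = \<sigma>\<^sup>2 * q x - \<sigma>\<^sup>2 * (mean_kernel (x u) * mean_kernel (x v))"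
      by (simp add: b_def algebra_simps power2_eq_square)
    also have "\<dots> \<le> \<sigma>\<^sup>2 * q x"
      by (simp add: mean_kernel_nonneg)
    also have "\<dots> \<le> 1 * q x"
      using assms q0 by (intro mult_right_mono) (auto simp: power_le_one)
    finally show ?thesis
      by simp
  qed
  have [measurable]: "a \<in> borel_measurable ?P" "b \<in> borel_measurable ?P" "q \<in> borel_measurable ?P"
    unfolding a_def b_def q_def by measurable
  have int_an: "integrable ?P (\<lambda>x. a x ^ n)"
    using a0 a1 by (intro P.integrable_const_bound[of _ 1]) (auto simp: power_le_one intro!: AE_I2 norm_le_1I)
  have int_bn: "integrable ?P (\<lambda>x. b x ^ n)"
    using b01 by (intro P.integrable_const_bound[of _ 1]) (auto simp: power_le_one intro!: AE_I2 norm_le_1I)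
  have int_qn: "integrable ?P q"
    using q0 q1 by (intro P.integrable_const_bound[of _ 1]) (auto intro!: AE_I2)
  have card: "card (I - ?U) = n"
    using assms by (simp add: n_def card_Diff_subset)
  have "(\<integral>x. (\<Prod>w\<in>I - ?U. (1 - \<sigma> * c (x u) (x w)) * (1 - \<sigma> * c (x v) (x w))) \<partial>PiM I (\<lambda>_. M)) = (\<integral>x. a x ^ n \<partial>?P)"
    using integral_prod_kernel[of I ?U \<sigma>] assms card by (simp add: a_def)
  also have "\<dots> \<le> (\<integral>x. b x ^ n + real n * q x \<partial>?P)"
    using int_an int_bn int_qn a0 a1 b01 ab q0
    by (intro integral_mono power_le_power_add) auto
  also have "\<dots> = (\<integral>x. b x ^ n \<partial>?P) + real n * (\<integral>x. q x \<partial>?P)"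
    using int_bn int_qn by simp
  also have "(\<integral>x. b x ^ n \<partial>?P) = (\<integral>x. (1 - \<sigma> * mean_kernel x) ^ n \<partial>M)\<^sup>2"
  proof -
    have "integrable M (\<lambda>x. (1 - \<sigma> * mean_kernel x) ^ n)"
      using mbounds by (intro integrable_const_bound[of _ 1]) (auto simp: power_le_one intro!: AE_I2 norm_le_1I)
    then have "(\<integral>x. (\<Prod>z\<in>?U. (1 - \<sigma> * mean_kernel (x z)) ^ n) \<partial>?P) = (\<Prod>z\<in>?U. \<integral>x. (1 - \<sigma> * mean_kernel x) ^ n \<partial>M)"
      by (intro product_integral_prod) auto
    then show ?thesis
      using assms by (simp add: b_def power_mult_distrib power2_eq_square)
  qed
  \<comment> \<open>After exchanging the integrals the common neighbour \<open>y\<close> is fixed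
    and the positions of \<open>u\<close> and \<open>v\<close> are independent; symmetry of
    \<open>c\<close> then gives \<open>(mean_kernel y)\<^sup>2\<close>.\<close>
  also have "(\<integral>x. q x \<partial>?P) = (\<integral>y. (\<integral>x. c (x u) y * c (x v) y \<partial>?P) \<partial>M)"
    unfolding q_def
  proof (rule PM.Fubini_integral[symmetric])
    show "integrable (?P \<Otimes>\<^sub>M M) (\<lambda>(x, y). c (x u) y * c (x v) y)"
      by (rule PM.P.integrable_const_bound[of _ 1])
        (auto simp: kernel_nonneg kernel_le_1 mult_le_one intro!: AE_I2 norm_le_1I)
  qed
  also have "\<dots> = (\<integral>y. (mean_kernel y)\<^sup>2 \<partial>M)"
  proof (rule Bochner_Integration.integral_cong[OF refl])
    fix y assume y: "y \<in> space M"
    have "(\<integral>x. (\<Prod>z\<in>?U. c y (x z)) \<partial>?P) = (\<Prod>z\<in>?U. \<integral>x. c y x \<partial>M)"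
      using y by (intro product_integral_prod integrable_kernel) auto
    then show "(\<integral>x. c (x u) y * c (x v) y \<partial>?P) = (mean_kernel y)\<^sup>2"
      using assms by (simp add: mean_kernel_def power2_eq_square kernel_commute[of _ y])
  qed
  also have "real n * (\<integral>y. (mean_kernel y)\<^sup>2 \<partial>M) \<le> card I * (\<integral>y. (mean_kernel y)\<^sup>2 \<partial>M)"
    by (intro mult_right_mono Bochner_Integration.integral_nonneg) (auto simp: n_def)
  finally show ?thesis
    by (simp add: n_def)
qed

end

subsection \<open>Limits of the averaged quantities\<close>

text \<open>Comparison with \<open>exp (- a n) ^ (n - j)\<close>: each factor changes by at most
  \<open>(a n)\<^sup>2\<close>, hence the power by at most \<open>(n - j) * (a n)\<^sup>2\<close>,
  which tends to 0 because \<open>n * a n\<close> stays bounded. The offset \<open>j\<close> covers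
  the exponents \<open>N - 1\<close> for one vertex and \<open>N - 2\<close> for two.\<close>

lemma tendsto_one_minus_power:
  fixes a :: "nat \<Rightarrow> real"
  assumes "(\<lambda>n. real n * a n) \<longlonglongrightarrow> l" and nonneg: "\<And>n. 0 \<le> a n" and le_1: "\<forall>\<^sub>F n in sequentially. a n \<le> 1"
  shows "(\<lambda>n. (1 - a n) ^ (n - j)) \<longlonglongrightarrow> exp (- l)"
proof -
  have "(\<lambda>n. (real n * a n) * (1 / real n)) \<longlonglongrightarrow> l * 0"
    by (intro tendsto_mult assms lim_1_over_n)
  moreover have "\<forall>\<^sub>F n in sequentially. (real n * a n) * (1 / real n) = a n"
    using eventually_gt_at_top[of 0] by eventually_elim simp
  ultimately have a0: "a \<longlonglongrightarrow> 0"
    using Lim_transform_eventually by fastforce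
  have n: "(\<lambda>n. real (n - j) * a n) \<longlonglongrightarrow> l"
  proof (rule Lim_transform_eventually)
    show "(\<lambda>n. real n * a n - real j * a n) \<longlonglongrightarrow> l"
      using tendsto_diff[OF assms(1) tendsto_mult[OF tendsto_const a0, of "real j"]] by simp
    show "\<forall>\<^sub>F n in sequentially. real n * a n - real j * a n = real (n - j) * a n"
      using eventually_ge_at_top[of j] by eventually_elim (simp add: of_nat_diff algebra_simps)
  qed
  have "(\<lambda>n. (1 - a n) ^ (n - j) - exp (- (real (n - j) * a n))) \<longlonglongrightarrow> 0"
  proof (rule Lim_null_comparison)
    show "(\<lambda>n. (real (n - j) * a n) * a n) \<longlonglongrightarrow> 0"
      using tendsto_mult[OF n a0] by simp
    show "\<forall>\<^sub>F n in sequentially. norm ((1 - a n) ^ (n - j) - exp (- (real (n - j) * a n))) \<le> (real (n - j) * a n) * a n"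
      using le_1
    proof eventually_elim
      case (elim n)
      have a: "0 \<le> a n"
        by (rule nonneg)
      \<comment> \<open>The upper half of the estimate for \<open>(1 - a n) - exp (- a n)\<close> in
        absolute value; the lower half is \<open>1 - a n \<le> exp (- a n)\<close>.\<close>
      have "exp (- a n) = 1 / exp (a n)"
        by (simp add: exp_minus inverse_eq_divide)
      also have "\<dots> \<le> 1 / (1 + a n)"
        using a exp_ge_add_one_self[of "a n"] by (intro divide_left_mono) auto
      also have "\<dots> \<le> 1 - a n + a n * a n"
        using a by (simp add: field_simps)
      finally have "\<bar>(1 - a n) - exp (- a n)\<bar> \<le> a n * a n"
        using exp_ge_add_one_self[of "- a n"] by linarith
      then have "real (n - j) * \<bar>(1 - a n) - exp (- a n)\<bar> \<le> real (n - j) * (a n * a n)"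
        by (intro mult_left_mono) auto
      moreover have "\<bar>(1 - a n) ^ (n - j) - exp (- a n) ^ (n - j)\<bar> \<le> real (n - j) * \<bar>(1 - a n) - exp (- a n)\<bar>"
        using norm_power_diff[of "1 - a n" "exp (- a n)" "n - j"] elim a by simp
      moreover have "exp (- a n) ^ (n - j) = exp (- (real (n - j) * a n))"
        using exp_of_nat_mult[of "n - j" "- a n"] by simp
      ultimately show ?case
        by (simp add: mult.assoc)
    qed
  qed
  moreover have "(\<lambda>n. exp (- (real (n - j) * a n))) \<longlonglongrightarrow> exp (- l)"
    by (intro tendsto_intros n)
  ultimately have "(\<lambda>n. ((1 - a n) ^ (n - j) - exp (- (real (n - j) * a n))) + exp (- (real (n - j) * a n))) \<longlonglongrightarrow> 0 + exp (- l)"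
    by (rule tendsto_add)
  then show ?thesis
    by simp
qed

lemma point_distribution_connection_kernel:
  assumes "\<alpha> > 0" "R > 0"
  shows "connection_kernel (point_distribution \<alpha> R) (connection_prob \<zeta> \<beta> R)"
proof -
  interpret prob_space "point_distribution \<alpha> R"
    by (rule prob_space_point_distribution[OF assms])
  show ?thesis
  proof
    show "(\<lambda>(x, y). connection_prob \<zeta> \<beta> R x y) \<in> borel_measurable (point_distribution \<alpha> R \<Otimes>\<^sub>M point_distribution \<alpha> R)"
      using connection_prob_measurable
      by (subst measurable_cong_sets[OF sets_pair_measure_cong[OF sets_point_distribution sets_point_distribution] refl])
  qed (auto simp: connection_prob_nonneg connection_prob_le_1 intro: connection_prob_commute)
qed

lemma mean_kernel_point_distribution:
  assumes "\<alpha> > 0" "R > 0"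
  shows "connection_kernel.mean_kernel (point_distribution \<alpha> R) (connection_prob \<zeta> \<beta> R) x
    = radial_connection_prob \<zeta> \<alpha> \<beta> R (fst x)"
  unfolding connection_kernel.mean_kernel_def[OF point_distribution_connection_kernel[OF assms]]
  by (rule integral_connection_prob[OF assms])

lemma radial_connection_prob_le_1:
  assumes "\<alpha> > 0" "R > 0"
  shows "radial_connection_prob \<zeta> \<alpha> \<beta> R r \<le> 1"
proof -
  have "(r, 0) \<in> space (point_distribution \<alpha> R)"
    by (simp add: point_distribution_def space_pair_measure)
  from connection_kernel.mean_kernel_le_1[OF point_distribution_connection_kernel[OF assms] this] show ?thesis
    by (simp add: mean_kernel_point_distribution[OF assms])
qed

context hyperbolic_parameters
begin

abbreviation (input) conn :: "nat \<Rightarrow> real \<Rightarrow> real" where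
  "conn N r \<equiv> radial_connection_prob \<zeta> \<alpha> \<beta> (disc_radius \<zeta> N) r"

lemma eventually_disc_radius_pos: "\<forall>\<^sub>F N in sequentially. disc_radius \<zeta> N > 0"
  using filterlim_disc_radius[OF params(1)] unfolding filterlim_at_top_dense by blast

text \<open>The power stays in \<open>[0, 1]\<close>, so the bound on the radial density alone is a
  dominating function.\<close>

lemma tendsto_integral_one_minus_power:
  assumes "0 \<le> \<sigma>" "\<sigma> \<le> 1"
  shows "(\<lambda>N. \<integral>x. (1 - \<sigma> * conn N (fst x)) ^ (N - j) \<partial>point_distribution \<alpha> (disc_radius \<zeta> N))
    \<longlonglongrightarrow> (\<integral>t. exp (- \<sigma> * (mixing_constant \<zeta> \<alpha> \<beta> * exp (\<zeta> * t / 2))) \<partial>density lborel (exponential_density \<alpha>))"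
proof (rule Lim_transform_eventually)
  let ?f = "\<lambda>N t. radial_density \<alpha> (disc_radius \<zeta> N) (disc_radius \<zeta> N - t) *
    (1 - \<sigma> * conn N (disc_radius \<zeta> N - t)) ^ (N - j)"
  let ?l = "\<lambda>t. exponential_density \<alpha> t * exp (- \<sigma> * (mixing_constant \<zeta> \<alpha> \<beta> * exp (\<zeta> * t / 2)))"
  let ?w = "\<lambda>t. 4 * \<alpha> * (indicator {0..} t * exp (- \<alpha> * t))"
  have "(\<lambda>N. integral\<^sup>L lborel (?f N)) \<longlonglongrightarrow> integral\<^sup>L lborel ?l"
  proof (rule integral_dominated_convergence_eventually)
    show "integrable lborel ?w"
      using params by (intro integrable_mult_right integrable.intros[OF has_bochner_integral_exp_half_line]) auto
    have "(\<lambda>N. ?f N t) \<longlonglongrightarrow> ?l t" for t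
    proof (intro tendsto_mult tendsto_radial_density)
      have "(\<lambda>N. \<sigma> * (real N * conn N (disc_radius \<zeta> N - t))) \<longlonglongrightarrow> \<sigma> * (mixing_constant \<zeta> \<alpha> \<beta> * exp (\<zeta> * t / 2))"
        by (intro tendsto_mult tendsto_const tendsto_mult_radial_connection_prob)
      then have "(\<lambda>N. real N * (\<sigma> * conn N (disc_radius \<zeta> N - t))) \<longlonglongrightarrow> \<sigma> * (mixing_constant \<zeta> \<alpha> \<beta> * exp (\<zeta> * t / 2))"
        by (simp add: mult_ac)
      moreover have "\<forall>\<^sub>F N in sequentially. \<sigma> * conn N (disc_radius \<zeta> N - t) \<le> 1"
        using eventually_disc_radius_pos
        by eventually_elim (use assms params in \<open>auto intro!: mult_le_one radial_connection_prob_nonneg radial_connection_prob_le_1\<close>)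
      ultimately have "(\<lambda>N. (1 - \<sigma> * conn N (disc_radius \<zeta> N - t)) ^ (N - j))
          \<longlonglongrightarrow> exp (- (\<sigma> * (mixing_constant \<zeta> \<alpha> \<beta> * exp (\<zeta> * t / 2))))"
        using assms params by (intro tendsto_one_minus_power) (auto simp: radial_connection_prob_nonneg)
      then show "(\<lambda>N. (1 - \<sigma> * conn N (disc_radius \<zeta> N - t)) ^ (N - j))
          \<longlonglongrightarrow> exp (- \<sigma> * (mixing_constant \<zeta> \<alpha> \<beta> * exp (\<zeta> * t / 2)))"
        by simp
    qed
    then show "AE t in lborel. (\<lambda>N. ?f N t) \<longlonglongrightarrow> ?l t"
      by simp
    show "\<forall>\<^sub>F N in sequentially. \<forall>t. \<bar>?f N t\<bar> \<le> ?w t"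
      using eventually_radial_density_le eventually_disc_radius_pos
    proof eventually_elim
      case (elim N)
      show ?case
      proof
        fix t
        have "0 \<le> 1 - \<sigma> * conn N (disc_radius \<zeta> N - t)" "1 - \<sigma> * conn N (disc_radius \<zeta> N - t) \<le> 1"
          using assms params elim mult_le_one[of \<sigma> "conn N (disc_radius \<zeta> N - t)"]
          by (auto simp: radial_connection_prob_nonneg radial_connection_prob_le_1)
        then have "\<bar>?f N t\<bar> \<le> radial_density \<alpha> (disc_radius \<zeta> N) (disc_radius \<zeta> N - t) * 1"
          using params unfolding abs_mult
          by (intro mult_mono) (auto simp: radial_density_nonneg power_le_one)
        also have "\<dots> \<le> ?w t"
          using elim by simp
        finally show "\<bar>?f N t\<bar> \<le> ?w t" .
      qed
    qed
  qed auto
  moreover have "integral\<^sup>L lborel ?l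
      = (\<integral>t. exp (- \<sigma> * (mixing_constant \<zeta> \<alpha> \<beta> * exp (\<zeta> * t / 2))) \<partial>density lborel (exponential_density \<alpha>))"
    using params by (subst integral_density) (auto simp: exponential_density_nonneg)
  ultimately show "(\<lambda>N. integral\<^sup>L lborel (?f N))
      \<longlonglongrightarrow> (\<integral>t. exp (- \<sigma> * (mixing_constant \<zeta> \<alpha> \<beta> * exp (\<zeta> * t / 2))) \<partial>density lborel (exponential_density \<alpha>))"
    by simp
  show "\<forall>\<^sub>F N in sequentially. integral\<^sup>L lborel (?f N)
      = (\<integral>x. (1 - \<sigma> * conn N (fst x)) ^ (N - j) \<partial>point_distribution \<alpha> (disc_radius \<zeta> N))"
    using eventually_disc_radius_pos
    by eventually_elim (subst integral_point_distribution_radial, use params in auto)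
qed

text \<open>Pointwise, \<open>N * p\<^sup>2 = (N * p)\<^sup>2 / N\<close> tends to 0. For the
  domination only one factor is bounded by \<open>C * exp (\<zeta> * t / 2)\<close> and the other by
  1: using the exponential bound twice would require \<zeta> < \<alpha>.\<close>

lemma tendsto_mult_integral_square:
  "(\<lambda>N. real N * (\<integral>x. (conn N (fst x))\<^sup>2 \<partial>point_distribution \<alpha> (disc_radius \<zeta> N))) \<longlonglongrightarrow> 0"
proof (rule Lim_transform_eventually)
  obtain C where C: "\<forall>\<^sub>F N in sequentially. \<forall>t. t \<le> disc_radius \<zeta> N \<longrightarrow>
     real N * conn N (disc_radius \<zeta> N - t) \<le> C * exp (\<zeta> * t / 2)"
    by (rule eventually_mult_radial_connection_prob_le)
  let ?f = "\<lambda>N t. radial_density \<alpha> (disc_radius \<zeta> N) (disc_radius \<zeta> N - t) *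
    (real N * conn N (disc_radius \<zeta> N - t) * conn N (disc_radius \<zeta> N - t))"
  let ?w = "\<lambda>t. 4 * \<alpha> * \<bar>C\<bar> * (indicator {0..} t * exp (- (\<alpha> - \<zeta> / 2) * t))"
  have "(\<lambda>N. integral\<^sup>L lborel (?f N)) \<longlonglongrightarrow> integral\<^sup>L lborel (\<lambda>t :: real. 0 :: real)"
  proof (rule integral_dominated_convergence_eventually)
    show "integrable lborel ?w"
      by (rule integrable_scaled_density_bound)
    have "(\<lambda>N. ?f N t) \<longlonglongrightarrow> 0" for t
    proof -
      let ?m = "mixing_constant \<zeta> \<alpha> \<beta> * exp (\<zeta> * t / 2)"
      have "(\<lambda>N. radial_density \<alpha> (disc_radius \<zeta> N) (disc_radius \<zeta> N - t) *
          (real N * conn N (disc_radius \<zeta> N - t) * (real N * conn N (disc_radius \<zeta> N - t) * (1 / real N))))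
        \<longlonglongrightarrow> exponential_density \<alpha> t * (?m * (?m * 0))"
        by (intro tendsto_mult[OF tendsto_radial_density] tendsto_mult[OF tendsto_mult_radial_connection_prob] lim_1_over_n)
      moreover have "(real N * conn N (disc_radius \<zeta> N - t) * (real N * conn N (disc_radius \<zeta> N - t) * (1 / real N)))
          = real N * conn N (disc_radius \<zeta> N - t) * conn N (disc_radius \<zeta> N - t)" for N
        by (cases "N = 0") auto
      ultimately show ?thesis
        by (simp only: mult_zero_right)
    qed
    then show "AE t in lborel. (\<lambda>N. ?f N t) \<longlonglongrightarrow> 0"
      by simp
    show "\<forall>\<^sub>F N in sequentially. \<forall>t. \<bar>?f N t\<bar> \<le> ?w t"
      using eventually_radial_density_le eventually_disc_radius_pos C
    proof eventually_elim
      case (elim N)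
      show ?case
      proof
        fix t
        have p: "0 \<le> conn N (disc_radius \<zeta> N - t)" "conn N (disc_radius \<zeta> N - t) \<le> 1"
          using params elim by (auto simp: radial_connection_prob_nonneg radial_connection_prob_le_1)
        show "\<bar>?f N t\<bar> \<le> ?w t"
        proof (cases "t \<le> disc_radius \<zeta> N")
          case True
          have "real N * conn N (disc_radius \<zeta> N - t) * conn N (disc_radius \<zeta> N - t)
              \<le> real N * conn N (disc_radius \<zeta> N - t) * 1"
            using p by (intro mult_left_mono) auto
          also have "\<dots> \<le> C * exp (\<zeta> * t / 2)"
            using elim True by simp
          also have "\<dots> \<le> \<bar>C\<bar> * exp (\<zeta> * t / 2)"
            by simp
          finally have "radial_density \<alpha> (disc_radius \<zeta> N) (disc_radius \<zeta> N - t) *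
              (real N * conn N (disc_radius \<zeta> N - t) * conn N (disc_radius \<zeta> N - t))
            \<le> 4 * \<alpha> * (indicator {0..} t * exp (- \<alpha> * t)) * (\<bar>C\<bar> * exp (\<zeta> * t / 2))"
            by (rule mult_mono[rotated]) (use elim p params in auto)
          then have "\<bar>?f N t\<bar> \<le> 4 * \<alpha> * (indicator {0..} t * exp (- \<alpha> * t)) * (\<bar>C\<bar> * exp (\<zeta> * t / 2))"
            using p by (simp add: radial_density_nonneg)
          also have "\<dots> = 4 * \<alpha> * \<bar>C\<bar> * (indicator {0..} t * (exp (- \<alpha> * t) * exp (\<zeta> * t / 2)))"
            by simp
          also have "exp (- \<alpha> * t) * exp (\<zeta> * t / 2) = exp (- (\<alpha> - \<zeta> / 2) * t)"
            unfolding exp_add[symmetric] by (simp add: algebra_simps)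
          finally show ?thesis .
        next
          case False
          then have "radial_density \<alpha> (disc_radius \<zeta> N) (disc_radius \<zeta> N - t) = 0"
            by (simp add: radial_density_def)
          then show ?thesis
            using params by simp
        qed
      qed
    qed
  qed auto
  then show "(\<lambda>N. integral\<^sup>L lborel (?f N)) \<longlonglongrightarrow> 0"
    by simp
  show "\<forall>\<^sub>F N in sequentially. integral\<^sup>L lborel (?f N)
      = real N * (\<integral>x. (conn N (fst x))\<^sup>2 \<partial>point_distribution \<alpha> (disc_radius \<zeta> N))"
    using eventually_disc_radius_pos
  proof eventually_elim
    case (elim N)
    have "(\<integral>x. (conn N (fst x))\<^sup>2 \<partial>point_distribution \<alpha> (disc_radius \<zeta> N))
        = (\<integral>t. radial_density \<alpha> (disc_radius \<zeta> N) (disc_radius \<zeta> N - t) * (conn N (disc_radius \<zeta> N - t))\<^sup>2 \<partial>lborel)"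
      using elim params by (subst integral_point_distribution_radial) auto
    then show ?case
      by (simp add: power2_eq_square mult_ac flip: integral_mult_right_zero)
  qed
qed

end

subsection \<open>Conditional independence of the edges\<close>

text \<open>The random variable \<open>Z N s\<close> of the overview, that is, the generating
  function of the empirical degree distribution.\<close>

definition degree_gf :: "nat \<Rightarrow> real \<Rightarrow> edges \<Rightarrow> real" where
  "degree_gf N s G = (\<Sum>v<N. s ^ vertex_degree N G v) / real N"

text \<open>Rewrites the power as a product over potential neighbours, the form to which
  independence of the edges applies. For \<open>s = 0\<close> both sides indicate an isolated
  vertex.\<close>

lemma power_vertex_degree_eq:
  fixes s :: real
  shows "s ^ vertex_degree N G v = (\<Prod>w\<in>{..<N} - {v}. if adjacent G w v then s else 1)"
proof -
  have "vertex_degree N G v = card {w \<in> {..<N} - {v}. adjacent G w v}"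
    unfolding vertex_degree_def by (intro arg_cong[where f = card]) (auto simp: adjacent_def)
  moreover have "(\<Prod>w\<in>{..<N} - {v}. if adjacent G w v then s else 1) = (\<Prod>w\<in>{w \<in> {..<N} - {v}. adjacent G w v}. s)"
    by (intro prod.inter_filter[symmetric]) auto
  ultimately show ?thesis
    by simp
qed

lemma prod_le_prod_subset:
  fixes f :: "'a \<Rightarrow> real"
  assumes "finite B" "A \<subseteq> B" "\<And>b. b \<in> B \<Longrightarrow> 0 \<le> f b \<and> f b \<le> 1"
  shows "prod f B \<le> prod f A"
proof -
  have "prod f B = prod f (B - A) * prod f A"
    using assms by (intro prod.subset_diff)
  also have "\<dots> \<le> 1 * prod f A"
    using assms by (intro mult_right_mono prod_le_1 prod_nonneg) auto
  finally show ?thesis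
    by simp
qed

text \<open>A pair with exactly one endpoint in \<open>U\<close> occurs once, so the factors belong
  to distinct edges and the expectation factorizes. Pairs inside \<open>U\<close> are absent; for
  two vertices this is the dropped edge.\<close>

lemma expectation_prod_adjacent:
  assumes "U \<subseteq> {..<N}" "0 \<le> s"
  shows "measure_pmf.expectation (edges_given_positions \<zeta> \<beta> N x)
      (\<lambda>G. \<Prod>w\<in>{..<N} - U. \<Prod>z\<in>U. if adjacent G w z then s else 1)
    = (\<Prod>w\<in>{..<N} - U. \<Prod>z\<in>U. 1 - (1 - s) * connection_prob \<zeta> \<beta> (disc_radius \<zeta> N) (x z) (x w))"
proof -
  define P where "P = {(u, v). u < v \<and> v < N}"
  \<comment> \<open>Sorts a pair into the form that encodes an edge. It is injective on
    \<open>W\<close> because only the second component lies in \<open>U\<close>.\<close>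
  define e where "e = (\<lambda>(w, z). (min w z, max w z :: nat))"
  define W where "W = ({..<N} - U) \<times> U"
  define c where "c = (\<lambda>(u, v). connection_prob \<zeta> \<beta> (disc_radius \<zeta> N) (x u) (x v))"
  \<comment> \<open>Edges not coming from \<open>W\<close> get the factor 1, so that the product
    formula for all independent edges in \<open>P\<close> applies.\<close>
  define f where "f = (\<lambda>p b. if p \<in> e ` W \<and> b then s else 1)"
  have P: "finite P"
    by (rule finite_subset[of _ "{..<N} \<times> {..<N}"]) (auto simp: P_def)
  have U: "finite U"
    using assms finite_subset by blast
  have inj: "inj_on e W"
    by (auto simp: inj_on_def e_def W_def min_def max_def split: if_splits)
  have sub: "e ` W \<subseteq> P"
    using assms by (auto simp: e_def W_def P_def min_def max_def) (metis linorder_neqE_nat order_less_le)+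
  have c01: "0 \<le> c p" "c p \<le> 1" for p
    by (auto simp: c_def connection_prob_nonneg connection_prob_le_1 split: prod.splits)
  have "(\<Prod>w\<in>{..<N} - U. \<Prod>z\<in>U. if adjacent G w z then s else 1) = (\<Prod>p\<in>P. f p (G p))" for G
  proof -
    have "(\<Prod>w\<in>{..<N} - U. \<Prod>z\<in>U. if adjacent G w z then s else 1) = (\<Prod>(w, z)\<in>W. if adjacent G w z then s else 1)"
      unfolding W_def by (rule prod.cartesian_product)
    also have "\<dots> = (\<Prod>q\<in>W. f (e q) (G (e q)))"
    proof (intro prod.cong refl)
      fix q assume q: "q \<in> W"
      obtain w z where wz: "q = (w, z)" "w \<noteq> z"
        using q by (auto simp: W_def)
      then have "adjacent G w z \<longleftrightarrow> G (e q)"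
        by (cases "w < z") (auto simp: adjacent_def e_def min_def max_def)
      then show "(case q of (w, z) \<Rightarrow> if adjacent G w z then s else 1) = f (e q) (G (e q))"
        using q wz by (simp add: f_def)
    qed
    also have "\<dots> = (\<Prod>p\<in>e ` W. f p (G p))"
      using inj by (simp add: prod.reindex)
    also have "\<dots> = (\<Prod>p\<in>P. f p (G p))"
      using P sub by (intro prod.mono_neutral_left) (auto simp: f_def)
    finally show ?thesis .
  qed
  then have "measure_pmf.expectation (edges_given_positions \<zeta> \<beta> N x)
      (\<lambda>G. \<Prod>w\<in>{..<N} - U. \<Prod>z\<in>U. if adjacent G w z then s else 1)
    = measure_pmf.expectation (Pi_pmf P False (\<lambda>p. bernoulli_pmf (c p))) (\<lambda>G. \<Prod>p\<in>P. f p (G p))"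
    by (simp add: edges_given_positions_def P_def c_def case_prod_unfold)
  also have "\<dots> = (\<Prod>p\<in>P. measure_pmf.expectation (bernoulli_pmf (c p)) (f p))"
    using P assms by (intro expectation_prod_Pi_pmf) (auto intro!: integrable_measure_pmf_finite simp: f_def)
  also have "\<dots> = (\<Prod>p\<in>P. if p \<in> e ` W then 1 - (1 - s) * c p else 1)"
    using c01 by (intro prod.cong refl) (auto simp: f_def algebra_simps)
  also have "\<dots> = (\<Prod>p\<in>e ` W. 1 - (1 - s) * c p)"
    using P sub by (intro prod.mono_neutral_cong_right) auto
  also have "\<dots> = (\<Prod>q\<in>W. 1 - (1 - s) * c (e q))"
    using inj by (simp add: prod.reindex)
  also have "\<dots> = (\<Prod>(w, z)\<in>W. 1 - (1 - s) * connection_prob \<zeta> \<beta> (disc_radius \<zeta> N) (x z) (x w))"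
    by (intro prod.cong refl) (auto simp: e_def c_def min_def max_def connection_prob_commute)
  also have "\<dots> = (\<Prod>w\<in>{..<N} - U. \<Prod>z\<in>U. 1 - (1 - s) * connection_prob \<zeta> \<beta> (disc_radius \<zeta> N) (x z) (x w))"
    unfolding W_def by (rule prod.cartesian_product[symmetric])
  finally show ?thesis .
qed

lemma
  fixes f :: "edges \<Rightarrow> real"
  assumes "\<zeta> > 0" "\<alpha> > 0" "N \<ge> 2" and bound: "\<And>G. \<bar>f G\<bar> \<le> B"
  shows integrable_random_graph: "integrable (random_graph \<zeta> \<alpha> \<beta> N) f"
    and integral_random_graph: "(\<integral>G. f G \<partial>random_graph \<zeta> \<alpha> \<beta> N)
      = (\<integral>x. measure_pmf.expectation (edges_given_positions \<zeta> \<beta> N x) f \<partial>positions \<zeta> \<alpha> N)"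
proof -
  interpret prob_space "positions \<zeta> \<alpha> N"
    using assms by (intro prob_space_positions)
  have AE: "AE x in positions \<zeta> \<alpha> N. emeasure (edges_given_positions \<zeta> \<beta> N x)
      (space (edges_given_positions \<zeta> \<beta> N x)) \<le> ennreal 1"
    by (simp add: measure_pmf.emeasure_space_1)
  show "integrable (random_graph \<zeta> \<alpha> \<beta> N) f"
    unfolding random_graph_def
    by (rule integrable_bind[OF _ bound measurable_prob_algebraD[OF edges_given_positions_measurable] finite_measure_axioms AE])
      auto
  show "(\<integral>G. f G \<partial>random_graph \<zeta> \<alpha> \<beta> N)
      = (\<integral>x. measure_pmf.expectation (edges_given_positions \<zeta> \<beta> N x) f \<partial>positions \<zeta> \<alpha> N)"
    unfolding random_graph_def
    by (rule integral_bind[OF _ bound measurable_prob_algebraD[OF edges_given_positions_measurable] finite_measure_axioms AE])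
      auto
qed

lemma disc_radius_pos: "\<zeta> > 0 \<Longrightarrow> N \<ge> 2 \<Longrightarrow> disc_radius \<zeta> N > 0"
  by (simp add: disc_radius_def)

lemma integral_power_vertex_degree:
  assumes "\<zeta> > 0" "\<alpha> > 0" "N \<ge> 2" "v < N" "0 \<le> s" "s \<le> 1"
  shows "(\<integral>G. s ^ vertex_degree N G v \<partial>random_graph \<zeta> \<alpha> \<beta> N)
    = (\<integral>x. (1 - (1 - s) * radial_connection_prob \<zeta> \<alpha> \<beta> (disc_radius \<zeta> N) (fst x)) ^ (N - 1)
        \<partial>point_distribution \<alpha> (disc_radius \<zeta> N))"
proof -
  have R: "disc_radius \<zeta> N > 0"
    using assms by (intro disc_radius_pos)
  interpret connection_kernel "point_distribution \<alpha> (disc_radius \<zeta> N)" "connection_prob \<zeta> \<beta> (disc_radius \<zeta> N)"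
    by (rule point_distribution_connection_kernel[OF assms(2) R])
  have "\<bar>s ^ n\<bar> \<le> 1" for n
    using assms by (simp add: power_le_one)
  then have "(\<integral>G. s ^ vertex_degree N G v \<partial>random_graph \<zeta> \<alpha> \<beta> N)
      = (\<integral>x. measure_pmf.expectation (edges_given_positions \<zeta> \<beta> N x) (\<lambda>G. s ^ vertex_degree N G v) \<partial>positions \<zeta> \<alpha> N)"
    using assms by (intro integral_random_graph)
  also have "\<dots> = (\<integral>x. (\<Prod>w\<in>{..<N} - {v}. 1 - (1 - s) * connection_prob \<zeta> \<beta> (disc_radius \<zeta> N) (x v) (x w)) \<partial>positions \<zeta> \<alpha> N)"
    using expectation_prod_adjacent[of "{v}" N s \<zeta> \<beta>] assms by (simp add: power_vertex_degree_eq)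
  also have "\<dots> = (\<integral>x. (1 - (1 - s) * mean_kernel x) ^ (N - 1) \<partial>point_distribution \<alpha> (disc_radius \<zeta> N))"
    unfolding positions_def using integral_prod_kernel_singleton[of "{..<N}" v "1 - s"] assms by simp
  finally show ?thesis
    by (simp add: mean_kernel_point_distribution[OF assms(2) R])
qed

text \<open>Both powers contain a factor for the edge between \<open>u\<close> and \<open>v\<close>.
  All factors lie in \<open>[0, 1]\<close>, so omitting these only increases the product; afterwards
  no edge is shared and the kernel estimate applies.\<close>

lemma integral_power_vertex_degree_mult_le:
  assumes "\<zeta> > 0" "\<alpha> > 0" "N \<ge> 2" "u < N" "v < N" "u \<noteq> v" "0 \<le> s" "s \<le> 1"
  shows "(\<integral>G. s ^ vertex_degree N G u * s ^ vertex_degree N G v \<partial>random_graph \<zeta> \<alpha> \<beta> N)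
    \<le> (\<integral>x. (1 - (1 - s) * radial_connection_prob \<zeta> \<alpha> \<beta> (disc_radius \<zeta> N) (fst x)) ^ (N - 2)
        \<partial>point_distribution \<alpha> (disc_radius \<zeta> N))\<^sup>2
      + real N * (\<integral>x. (radial_connection_prob \<zeta> \<alpha> \<beta> (disc_radius \<zeta> N) (fst x))\<^sup>2
        \<partial>point_distribution \<alpha> (disc_radius \<zeta> N))"
proof -
  have R: "disc_radius \<zeta> N > 0"
    using assms by (intro disc_radius_pos)
  interpret connection_kernel "point_distribution \<alpha> (disc_radius \<zeta> N)" "connection_prob \<zeta> \<beta> (disc_radius \<zeta> N)"
    by (rule point_distribution_connection_kernel[OF assms(2) R])
  interpret RG: prob_space "random_graph \<zeta> \<alpha> \<beta> N"
    using assms by (intro prob_space_random_graph)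
  let ?g = "\<lambda>G. \<Prod>w\<in>{..<N} - {u, v}. \<Prod>z\<in>{u, v}. if adjacent G w z then s else 1"
  have g01: "\<bar>?g G\<bar> \<le> 1" for G
    unfolding real_norm_def[symmetric] using assms by (intro norm_le_1I prod_nonneg prod_le_1 conjI) auto
  have "\<bar>s ^ n * s ^ m\<bar> \<le> 1" for n m
    using assms by (simp add: power_le_one flip: power_add)
  moreover have "s ^ vertex_degree N G u * s ^ vertex_degree N G v \<le> ?g G" for G
  proof -
    have "(\<Prod>w\<in>{..<N} - {z}. if adjacent G w z then s else 1) \<le> (\<Prod>w\<in>{..<N} - {u, v}. if adjacent G w z then s else 1)"
      if "z = u \<or> z = v" for z
      using that assms by (intro prod_le_prod_subset) auto
    then have "s ^ vertex_degree N G u * s ^ vertex_degree N G v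
       \<le> (\<Prod>w\<in>{..<N} - {u, v}. if adjacent G w u then s else 1) * (\<Prod>w\<in>{..<N} - {u, v}. if adjacent G w v then s else 1)"
      unfolding power_vertex_degree_eq using assms by (intro mult_mono prod_nonneg) auto
    then show ?thesis
      using assms by (simp add: prod.distrib)
  qed
  ultimately have "(\<integral>G. s ^ vertex_degree N G u * s ^ vertex_degree N G v \<partial>random_graph \<zeta> \<alpha> \<beta> N)
      \<le> (\<integral>G. ?g G \<partial>random_graph \<zeta> \<alpha> \<beta> N)"
    using assms g01 by (intro integral_mono integrable_random_graph) auto
  also have "\<dots> = (\<integral>x. measure_pmf.expectation (edges_given_positions \<zeta> \<beta> N x) ?g \<partial>positions \<zeta> \<alpha> N)"
    using assms g01 by (intro integral_random_graph)
  also have "\<dots> = (\<integral>x. (\<Prod>w\<in>{..<N} - {u, v}. (1 - (1 - s) * connection_prob \<zeta> \<beta> (disc_radius \<zeta> N) (x u) (x w))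
       * (1 - (1 - s) * connection_prob \<zeta> \<beta> (disc_radius \<zeta> N) (x v) (x w))) \<partial>positions \<zeta> \<alpha> N)"
    using expectation_prod_adjacent[of "{u, v}" N s \<zeta> \<beta>] assms by simp
  also have "\<dots> \<le> (\<integral>x. (1 - (1 - s) * mean_kernel x) ^ (N - 2) \<partial>point_distribution \<alpha> (disc_radius \<zeta> N))\<^sup>2
      + real N * (\<integral>x. (mean_kernel x)\<^sup>2 \<partial>point_distribution \<alpha> (disc_radius \<zeta> N))"
    unfolding positions_def using integral_prod_kernel_pair_le[of "{..<N}" u v "1 - s"] assms by simp
  finally show ?thesis
    by (simp add: mean_kernel_point_distribution[OF assms(2) R])
qed

subsection \<open>Convergence of the empirical generating function\<close>

lemma space_random_graph: "space (random_graph \<zeta> \<alpha> \<beta> N) = UNIV"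
  using sets_eq_imp_space_eq[of "random_graph \<zeta> \<alpha> \<beta> N" "count_space UNIV"] by (simp add: sets_random_graph)

lemma degree_gf_bounds:
  assumes "0 \<le> s" "s \<le> 1"
  shows "0 \<le> degree_gf N s G" "degree_gf N s G \<le> 1"
proof -
  show "0 \<le> degree_gf N s G"
    unfolding degree_gf_def using assms by (intro divide_nonneg_nonneg sum_nonneg) auto
  have "(\<Sum>v<N. s ^ vertex_degree N G v) \<le> (\<Sum>v<N. 1)"
    using assms by (intro sum_mono power_le_one)
  then show "degree_gf N s G \<le> 1"
    by (simp add: degree_gf_def divide_le_eq)
qed

context hyperbolic_parameters
begin

text \<open>The mixed Poisson generating function, as the average of
  \<open>exp (- (1 - s) * l)\<close> over \<open>l = K * exp (\<zeta> * T / 2)\<close> with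
  \<open>T\<close> exponential of rate \<alpha>. That this \<open>l\<close> has distribution
  function \<open>mixing_cdf\<close> is shown in \<open>interval_measure_mixing_cdf\<close>.\<close>

definition limit_gf :: "real \<Rightarrow> real" where
  "limit_gf s = (\<integral>t. exp (- (1 - s) * (mixing_constant \<zeta> \<alpha> \<beta> * exp (\<zeta> * t / 2)))
     \<partial>density lborel (exponential_density \<alpha>))"

text \<open>Expanding the square needs the exact mean, which enters with coefficient
  \<open>- 2 * l\<close>, but the second moment only from above. The diagonal pairs account for
  \<open>1 / N\<close>.\<close>

lemma integral_degree_gf_diff_square_le:
  assumes "N \<ge> 2" "0 \<le> s" "s \<le> 1"
  shows "(\<integral>G. (degree_gf N s G - l)\<^sup>2 \<partial>random_graph \<zeta> \<alpha> \<beta> N)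
    \<le> 1 / real N
      + ((\<integral>x. (1 - (1 - s) * conn N (fst x)) ^ (N - 2) \<partial>point_distribution \<alpha> (disc_radius \<zeta> N))\<^sup>2
      + real N * (\<integral>x. (conn N (fst x))\<^sup>2 \<partial>point_distribution \<alpha> (disc_radius \<zeta> N)))
      - 2 * l * (\<integral>x. (1 - (1 - s) * conn N (fst x)) ^ (N - 1) \<partial>point_distribution \<alpha> (disc_radius \<zeta> N)) + l\<^sup>2"
    (is "_ \<le> 1 / real N + ?T - 2 * l * ?A + l\<^sup>2")
proof -
  interpret RG: prob_space "random_graph \<zeta> \<alpha> \<beta> N"
    using assms params by (intro prob_space_random_graph)
  let ?RG = "random_graph \<zeta> \<alpha> \<beta> N"
  let ?d = "vertex_degree N"
  have N: "real N > 0"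
    using assms by simp
  have T: "0 \<le> ?T"
    by (intro add_nonneg_nonneg mult_nonneg_nonneg Bochner_Integration.integral_nonneg) auto
  have pow: "\<bar>s ^ n\<bar> \<le> 1" for n
    using assms by (simp add: power_le_one)
  have pow2: "\<bar>s ^ n * s ^ m\<bar> \<le> 1" for n m
    using pow[of "n + m"] by (simp add: power_add)
  have int1: "integrable ?RG (\<lambda>G. s ^ ?d G v)" for v
    using assms params pow by (intro integrable_random_graph)
  have int2: "integrable ?RG (\<lambda>G. s ^ ?d G u * s ^ ?d G v)" for u v
    using assms params pow2 by (intro integrable_random_graph)
  have intZ: "integrable ?RG (degree_gf N s)"
    using degree_gf_bounds[OF assms(2,3)] params assms
    by (intro integrable_random_graph[where B = 1]) auto
  have intZ2: "integrable ?RG (\<lambda>G. (degree_gf N s G)\<^sup>2)"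
    using degree_gf_bounds[OF assms(2,3)] params assms
    by (intro integrable_random_graph[where B = 1]) (auto simp: power_le_one)
  have Z: "(\<integral>G. degree_gf N s G \<partial>?RG) = ?A"
  proof -
    have "(\<integral>G. degree_gf N s G \<partial>?RG) = (\<Sum>v<N. \<integral>G. s ^ ?d G v \<partial>?RG) / real N"
      unfolding degree_gf_def using int1 by simp
    also have "(\<Sum>v<N. \<integral>G. s ^ ?d G v \<partial>?RG) = (\<Sum>v<N. ?A)"
      using assms params by (intro sum.cong refl integral_power_vertex_degree) auto
    finally show ?thesis
      using N by simp
  qed
  have "(\<integral>G. (degree_gf N s G)\<^sup>2 \<partial>?RG) = (\<integral>G. (\<Sum>u<N. \<Sum>v<N. s ^ ?d G u * s ^ ?d G v) / (real N)\<^sup>2 \<partial>?RG)"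
    by (simp add: degree_gf_def power_divide power2_eq_square sum_product)
  also have "\<dots> = (\<Sum>u<N. \<Sum>v<N. \<integral>G. s ^ ?d G u * s ^ ?d G v \<partial>?RG) / (real N)\<^sup>2"
    using int2 by simp
  \<comment> \<open>The nonnegative term \<open>?T\<close> is granted to the diagonal pairs as well,
    so that all pairs carry the same summand.\<close>
  also have "\<dots> \<le> (\<Sum>u<N. \<Sum>v<N. (if v = u then 1 else 0) + ?T) / (real N)\<^sup>2"
  proof (intro divide_right_mono sum_mono)
    fix u v assume uv: "u \<in> {..<N}" "v \<in> {..<N}"
    show "(\<integral>G. s ^ ?d G u * s ^ ?d G v \<partial>?RG) \<le> (if v = u then 1 else 0) + ?T"
    proof (cases "v = u")
      case True
      have "(\<integral>G. s ^ ?d G u * s ^ ?d G v \<partial>?RG) \<le> (\<integral>G. 1 \<partial>?RG)"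
        using int2 pow2 by (intro integral_mono) (auto intro: order_trans[OF abs_ge_self])
      also have "\<dots> \<le> 1 + ?T"
        unfolding RG.prob_space lebesgue_integral_const using T by simp
      finally show ?thesis
        using True by (simp only: refl if_True)
    next
      case False
      then show ?thesis
        using integral_power_vertex_degree_mult_le[of \<zeta> \<alpha> N u v s \<beta>] assms params uv by simp
    qed
  qed auto
  also have "(\<Sum>u<N. \<Sum>v<N. (if v = u then 1 else 0) + ?T) = real N + (real N)\<^sup>2 * ?T"
    by (simp add: sum.distrib power2_eq_square algebra_simps)
  also have "\<dots> / (real N)\<^sup>2 = 1 / real N + ?T"
    using N by (simp add: add_divide_distrib power2_eq_square)
  finally have Z2: "(\<integral>G. (degree_gf N s G)\<^sup>2 \<partial>?RG) \<le> 1 / real N + ?T" .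
  have "(\<integral>G. (degree_gf N s G - l)\<^sup>2 \<partial>?RG) = (\<integral>G. (degree_gf N s G)\<^sup>2 - 2 * l * degree_gf N s G + l\<^sup>2 \<partial>?RG)"
    by (simp add: power2_diff algebra_simps)
  also have "\<dots> = (\<integral>G. (degree_gf N s G)\<^sup>2 \<partial>?RG) - 2 * l * ?A + l\<^sup>2"
    using intZ intZ2 by (simp add: Z RG.prob_space)
  finally show ?thesis
    using Z2 by simp
qed

lemma tendsto_integral_degree_gf_diff_square:
  assumes "0 \<le> s" "s \<le> 1"
  shows "(\<lambda>N. \<integral>G. (degree_gf N s G - limit_gf s)\<^sup>2 \<partial>random_graph \<zeta> \<alpha> \<beta> N) \<longlonglongrightarrow> 0"
proof (rule tendsto_sandwich[of "\<lambda>_. 0"])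
  let ?A = "\<lambda>j N. \<integral>x. (1 - (1 - s) * conn N (fst x)) ^ (N - j) \<partial>point_distribution \<alpha> (disc_radius \<zeta> N)"
  let ?B = "\<lambda>N. real N * (\<integral>x. (conn N (fst x))\<^sup>2 \<partial>point_distribution \<alpha> (disc_radius \<zeta> N))"
  let ?l = "limit_gf s"
  have A: "?A j \<longlonglongrightarrow> ?l" for j
    unfolding limit_gf_def using assms by (intro tendsto_integral_one_minus_power) auto
  \<comment> \<open>The exponents \<open>N - 2\<close> and \<open>N - 1\<close> have the same limit,
    so the bound tends to \<open>l\<^sup>2 - 2 * l\<^sup>2 + l\<^sup>2 = 0\<close>.\<close>
  have "(\<lambda>N. 1 / real N + ((?A 2 N)\<^sup>2 + ?B N) - 2 * ?l * ?A 1 N + ?l\<^sup>2) \<longlonglongrightarrow> 0 + (?l\<^sup>2 + 0) - 2 * ?l * ?l + ?l\<^sup>2"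
    by (intro tendsto_add tendsto_diff tendsto_power tendsto_mult[OF tendsto_const] A tendsto_mult_integral_square
        lim_1_over_n tendsto_const)
  then show "(\<lambda>N. 1 / real N + ((?A 2 N)\<^sup>2 + ?B N) - 2 * ?l * ?A 1 N + ?l\<^sup>2) \<longlonglongrightarrow> 0"
    by (simp add: power2_eq_square)
  show "\<forall>\<^sub>F N in sequentially. (\<integral>G. (degree_gf N s G - limit_gf s)\<^sup>2 \<partial>random_graph \<zeta> \<alpha> \<beta> N)
      \<le> 1 / real N + ((?A 2 N)\<^sup>2 + ?B N) - 2 * ?l * ?A 1 N + ?l\<^sup>2"
    using eventually_ge_at_top[of 2] by eventually_elim (intro integral_degree_gf_diff_square_le assms)
qed (auto intro!: always_eventually Bochner_Integration.integral_nonneg)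

lemma tendsto_measure_degree_gf:
  assumes "0 \<le> s" "s \<le> 1" "\<delta> > 0"
  shows "(\<lambda>N. measure (random_graph \<zeta> \<alpha> \<beta> N) {G. \<bar>degree_gf N s G - limit_gf s\<bar> > \<delta>}) \<longlonglongrightarrow> 0"
proof (rule tendsto_sandwich[of "\<lambda>_. 0"])
  show "(\<lambda>N. 1 / \<delta>\<^sup>2 * (\<integral>G. (degree_gf N s G - limit_gf s)\<^sup>2 \<partial>random_graph \<zeta> \<alpha> \<beta> N)) \<longlonglongrightarrow> 0"
    using tendsto_mult[OF tendsto_const tendsto_integral_degree_gf_diff_square[OF assms(1,2)], of "1 / \<delta>\<^sup>2"] by simp
  show "\<forall>\<^sub>F N in sequentially. measure (random_graph \<zeta> \<alpha> \<beta> N) {G. \<bar>degree_gf N s G - limit_gf s\<bar> > \<delta>}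
      \<le> 1 / \<delta>\<^sup>2 * (\<integral>G. (degree_gf N s G - limit_gf s)\<^sup>2 \<partial>random_graph \<zeta> \<alpha> \<beta> N)"
    using eventually_ge_at_top[of 2]
  proof eventually_elim
    case (elim N)
    interpret RG: prob_space "random_graph \<zeta> \<alpha> \<beta> N"
      using elim params by (intro prob_space_random_graph)
    have bound: "\<bar>(degree_gf N s G - limit_gf s)\<^sup>2\<bar> \<le> (1 + \<bar>limit_gf s\<bar>)\<^sup>2" for G
    proof -
      have "\<bar>degree_gf N s G - limit_gf s\<bar> \<le> 1 + \<bar>limit_gf s\<bar>"
        using degree_gf_bounds[OF assms(1,2), of N G] by linarith
      then have "\<bar>degree_gf N s G - limit_gf s\<bar>\<^sup>2 \<le> (1 + \<bar>limit_gf s\<bar>)\<^sup>2"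
        by (intro power_mono) auto
      then show ?thesis
        by simp
    qed
    have "{G. \<bar>degree_gf N s G - limit_gf s\<bar> > \<delta>} \<subseteq> {G. \<delta>\<^sup>2 \<le> (degree_gf N s G - limit_gf s)\<^sup>2}"
    proof
      fix G assume "G \<in> {G. \<bar>degree_gf N s G - limit_gf s\<bar> > \<delta>}"
      then have "\<delta>\<^sup>2 \<le> \<bar>degree_gf N s G - limit_gf s\<bar>\<^sup>2"
        using assms by (intro power_mono) auto
      then show "G \<in> {G. \<delta>\<^sup>2 \<le> (degree_gf N s G - limit_gf s)\<^sup>2}"
        by simp
    qed
    then have "RG.prob {G. \<bar>degree_gf N s G - limit_gf s\<bar> > \<delta>} \<le> RG.prob {G. \<delta>\<^sup>2 \<le> (degree_gf N s G - limit_gf s)\<^sup>2}"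
      by (intro RG.finite_measure_mono) (auto simp: sets_random_graph)
    also have "\<dots> \<le> (\<integral>G. (degree_gf N s G - limit_gf s)\<^sup>2 \<partial>random_graph \<zeta> \<alpha> \<beta> N) / \<delta>\<^sup>2"
    proof -
      have "integrable (random_graph \<zeta> \<alpha> \<beta> N) (\<lambda>G. (degree_gf N s G - limit_gf s)\<^sup>2)"
        using elim params bound by (intro integrable_random_graph)
      from integral_Markov_inequality_measure[OF this, of UNIV "\<delta>\<^sup>2"] show ?thesis
        using assms by (simp add: sets_random_graph space_random_graph)
    qed
    finally show ?case
      by simp
  qed
qed auto

end

subsection \<open>From generating functions to degree frequencies\<close>

text \<open>The error is uniform over all \<open>d\<close>, which is what allows averaging it over
  vertices and over Poisson laws alike, with the same coefficients.\<close>

lemma indicator_nat_approx_powers: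
  fixes k :: nat and \<epsilon> :: real
  assumes "\<epsilon> > 0"
  obtains a n where "\<And>d :: nat. \<bar>(\<Sum>j\<le>n. a j * ((1 / 2) ^ j) ^ d) - (if d = k then 1 else 0)\<bar> \<le> \<epsilon>"
proof -
  \<comment> \<open>A tent with peak at \<open>(1 / 2) ^ k\<close> and half-width
    \<open>(1 / 2) ^ (k + 1)\<close>, the distance to the nearest other power of
    \<open>1 / 2\<close>; hence it vanishes at all other powers.\<close>
  define g :: "real \<Rightarrow> real" where "g = (\<lambda>x. max 0 (1 - 2 ^ (k + 1) * \<bar>x - (1 / 2) ^ k\<bar>))"
  have "continuous_on {0..1} g"
    unfolding g_def by (intro continuous_intros)
  from Stone_Weierstrass_real_polynomial_function[OF compact_Icc this assms]
  obtain p where p: "real_polynomial_function p" "\<And>x. x \<in> {0..1} \<Longrightarrow> \<bar>g x - p x\<bar> < \<epsilon>"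
    by blast
  obtain a n where an: "p = (\<lambda>x. \<Sum>j\<le>n. a j * x ^ j)"
    using p(1) real_polynomial_function_iff_sum by blast
  have g: "g ((1 / 2) ^ d) = (if d = k then 1 else 0)" for d
  proof (cases "d = k")
    case False
    have "(1 / 2) ^ (k + 1) \<le> \<bar>(1 / 2) ^ d - (1 / 2 :: real) ^ k\<bar>"
    proof (cases "d < k")
      case True
      then have "(1 / 2 :: real) ^ k \<le> (1 / 2) ^ (d + 1)"
        by (intro power_decreasing) auto
      then have "2 * (1 / 2 :: real) ^ k \<le> (1 / 2) ^ d" "(1 / 2 :: real) ^ (k + 1) = (1 / 2) ^ k / 2"
        by auto
      then show ?thesis
        using zero_le_power[of "1 / 2 :: real" k] by linarith
    next
      case False
      then have "(1 / 2 :: real) ^ d \<le> (1 / 2) ^ (k + 1)"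
        using \<open>d \<noteq> k\<close> by (intro power_decreasing) auto
      moreover have "(1 / 2 :: real) ^ (k + 1) = (1 / 2) ^ k / 2"
        by simp
      ultimately show ?thesis
        by linarith
    qed
    then have "2 ^ (k + 1) * (1 / 2) ^ (k + 1) \<le> 2 ^ (k + 1) * \<bar>(1 / 2) ^ d - (1 / 2 :: real) ^ k\<bar>"
      by (intro mult_left_mono) auto
    moreover have "2 ^ (k + 1) * (1 / 2 :: real) ^ (k + 1) = 1"
      by (simp flip: power_mult_distrib del: power_Suc)
    ultimately have "1 - 2 ^ (k + 1) * \<bar>(1 / 2) ^ d - (1 / 2 :: real) ^ k\<bar> \<le> 0"
      by linarith
    then show ?thesis
      using False by (simp only: g_def if_False max_absorb1)
  qed (simp add: g_def)
  show ?thesis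
  proof (rule that)
    fix d :: nat
    have "(1 / 2 :: real) ^ d \<in> {0..1}"
      by (simp add: power_le_one)
    from p(2)[OF this] have "\<bar>(\<Sum>j\<le>n. a j * ((1 / 2) ^ d) ^ j) - (if d = k then 1 else 0)\<bar> \<le> \<epsilon>"
      unfolding g an by linarith
    \<comment> \<open>Exchanging the exponents turns the monomial of degree \<open>j\<close> into
      the generating function argument \<open>(1 / 2) ^ j\<close>.\<close>
    then show "\<bar>(\<Sum>j\<le>n. a j * ((1 / 2) ^ j) ^ d) - (if d = k then 1 else 0)\<bar> \<le> \<epsilon>"
      by (simp add: mult.commute flip: power_mult)
  qed
qed

lemma poisson_gf_sums:
  fixes l s :: real
  shows "(\<lambda>d. exp (- l) * l ^ d / fact d * s ^ d) sums exp (- (1 - s) * l)"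
proof -
  have "(\<lambda>d. exp (- l) * ((l * s) ^ d /\<^sub>R fact d)) sums (exp (- l) * exp (l * s))"
    by (intro sums_mult exp_converges)
  moreover have "exp (- l) * exp (l * s) = exp (- (1 - s) * l)"
    by (simp add: algebra_simps flip: exp_add)
  ultimately show ?thesis
    by (simp add: power_mult_distrib divide_inverse mult_ac)
qed

text \<open>The approximation in \<open>d\<close> is averaged with Poisson weights: they sum to 1,
  so the error survives unchanged, and \<open>s j ^ d\<close> averages to
  \<open>exp (- (1 - s j) * l)\<close>.\<close>

lemma poisson_prob_approx:
  fixes l :: real
  assumes "l \<ge> 0" and approx: "\<And>d :: nat. \<bar>(\<Sum>j\<le>n. a j * s j ^ d) - (if d = k then 1 else 0)\<bar> \<le> \<epsilon>"
  shows "\<bar>(\<Sum>j\<le>n. a j * exp (- (1 - s j) * l)) - exp (- l) * l ^ k / fact k\<bar> \<le> \<epsilon>"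
proof -
  define w where "w = (\<lambda>d. exp (- l) * l ^ d / fact d)"
  have w: "0 \<le> w d" for d
    using assms by (simp add: w_def)
  have "(\<lambda>d. \<Sum>j\<le>n. a j * (w d * s j ^ d)) sums (\<Sum>j\<le>n. a j * exp (- (1 - s j) * l))"
    unfolding w_def by (intro sums_sum sums_mult poisson_gf_sums)
  moreover have "(\<lambda>d. if d = k then w d else 0) sums w k"
    by (rule sums_single)
  ultimately have "(\<lambda>d. (\<Sum>j\<le>n. a j * (w d * s j ^ d)) - (if d = k then w d else 0))
      sums ((\<Sum>j\<le>n. a j * exp (- (1 - s j) * l)) - w k)"
    by (rule sums_diff)
  moreover have "(\<Sum>j\<le>n. a j * (w d * s j ^ d)) - (if d = k then w d else 0)
      = w d * ((\<Sum>j\<le>n. a j * s j ^ d) - (if d = k then 1 else 0))" for d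
    by (simp add: right_diff_distrib sum_distrib_left mult_ac)
  ultimately have sums: "(\<lambda>d. w d * ((\<Sum>j\<le>n. a j * s j ^ d) - (if d = k then 1 else 0)))
      sums ((\<Sum>j\<le>n. a j * exp (- (1 - s j) * l)) - w k)"
    by simp
  have w_sums: "w sums 1"
    using poisson_gf_sums[of l 1] by (simp add: w_def)
  have le: "w d * ((\<Sum>j\<le>n. a j * s j ^ d) - (if d = k then 1 else 0)) \<le> w d * \<epsilon>"
    and ge: "w d * (- \<epsilon>) \<le> w d * ((\<Sum>j\<le>n. a j * s j ^ d) - (if d = k then 1 else 0))" for d
    using approx[of d] w[of d] unfolding abs_le_iff by (intro mult_left_mono; linarith)+
  have "(\<Sum>j\<le>n. a j * exp (- (1 - s j) * l)) - w k \<le> 1 * \<epsilon>"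
    by (rule sums_le[OF le sums sums_mult2[OF w_sums]])
  moreover have "1 * (- \<epsilon>) \<le> (\<Sum>j\<le>n. a j * exp (- (1 - s j) * l)) - w k"
    by (rule sums_le[OF ge sums_mult2[OF w_sums] sums])
  ultimately show ?thesis
    by (simp add: w_def abs_le_iff)
qed

section \<open>The Pareto mixing law and the passage to degree frequencies\<close>

context hyperbolic_parameters
begin

lemma mixing_constant_pos: "mixing_constant \<zeta> \<alpha> \<beta> > 0"
proof -
  have "sin (pi / \<beta>) > 0"
    using params by (intro sin_gt_zero) (auto simp: field_simps)
  then show ?thesis
    using params unfolding mixing_constant_def by (intro mult_pos_pos divide_pos_pos) auto
qed

text \<open>For \<open>T\<close> exponential of rate \<alpha>, the event
  \<open>K * exp (\<zeta> * T / 2) > x\<close> is \<open>T > \<tau>\<close> with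
  \<open>\<tau> = 2 / \<zeta> * ln (x / K)\<close>, whose probability for \<open>x \<ge> K\<close>
  is \<open>exp (- \<alpha> * \<tau>) = (K / x) powr (2 * \<alpha> / \<zeta>)\<close>.\<close>

lemma interval_measure_mixing_cdf:
  "interval_measure (mixing_cdf \<zeta> \<alpha> \<beta>)
     = distr (density lborel (exponential_density \<alpha>)) borel (\<lambda>t. mixing_constant \<zeta> \<alpha> \<beta> * exp (\<zeta> * t / 2))"
proof -
  define K where "K = mixing_constant \<zeta> \<alpha> \<beta>"
  have K: "K > 0"
    unfolding K_def by (rule mixing_constant_pos)
  define D where "D = distr (density lborel (exponential_density \<alpha>)) borel (\<lambda>t. K * exp (\<zeta> * t / 2))"
  interpret E: prob_space "density lborel (exponential_density \<alpha>)"
    using params by (intro prob_space_exponential_density)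
  interpret D: real_distribution D
    unfolding D_def by (rule E.real_distribution_distr) simp
  have "cdf D x = mixing_cdf \<zeta> \<alpha> \<beta> x" for x
  proof -
    have cdf: "cdf D x = E.prob {t. K * exp (\<zeta> * t / 2) \<le> x}"
      unfolding cdf_def D_def by (subst measure_distr) (auto simp: vimage_def)
    show ?thesis
    proof (cases "x > 0")
      case True
      define \<tau> where "\<tau> = 2 / \<zeta> * ln (x / K)"
      have "K * exp (\<zeta> * t / 2) \<le> x \<longleftrightarrow> t \<le> \<tau>" for t
      proof -
        have "K * exp (\<zeta> * t / 2) \<le> x \<longleftrightarrow> exp (\<zeta> * t / 2) \<le> x / K"
          using K by (simp add: field_simps)
        also have "\<dots> \<longleftrightarrow> \<zeta> * t / 2 \<le> ln (x / K)"
          using K True by (metis divide_pos_pos ln_ge_iff)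
        also have "\<dots> \<longleftrightarrow> t \<le> \<tau>"
          using params by (simp add: \<tau>_def field_simps)
        finally show ?thesis .
      qed
      then have "{t. K * exp (\<zeta> * t / 2) \<le> x} = {..\<tau>}"
        by auto
      moreover have "E.prob {..\<tau>} = erlang_CDF 0 \<alpha> \<tau>"
        using emeasure_erlang_density[of \<alpha> 0 \<tau>] params by (simp add: E.emeasure_eq_measure)
      \<comment> \<open>Matches the threshold 0 of the exponential distribution function with the
        threshold \<open>K\<close> of \<open>mixing_cdf\<close>.\<close>
      moreover have "\<tau> < 0 \<longleftrightarrow> x < K"
        using params True K by (simp add: \<tau>_def mult_less_0_iff divide_less_eq)
      moreover have "exp (- (\<alpha> * \<tau>)) = (K / x) powr (2 * \<alpha> / \<zeta>)"
      proof -
        have "- (\<alpha> * \<tau>) = 2 * \<alpha> / \<zeta> * ln (K / x)"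
          using True K by (simp add: \<tau>_def ln_div right_diff_distrib diff_divide_distrib mult_ac)
        then show ?thesis
          using True K by (simp add: powr_def)
      qed
      ultimately show ?thesis
        by (simp add: cdf mixing_cdf_def K_def[symmetric] erlang_CDF_def not_less)
    next
      case False
      then have "\<not> K * exp (\<zeta> * t / 2) \<le> x" for t
        using K by (smt (verit) exp_gt_zero mult_pos_pos)
      then show ?thesis
        using False K by (simp add: cdf mixing_cdf_def K_def[symmetric])
    qed
  qed
  \<comment> \<open>Since \<open>mixing_cdf\<close> is now the distribution function of a
    probability measure, the monotonicity, right continuity and limits that
    \<open>interval_measure\<close> requires come from that measure.\<close>
  then have F: "mixing_cdf \<zeta> \<alpha> \<beta> = cdf D"
    by auto
  have "real_distribution (interval_measure (cdf D))"
    using D.cdf_nondecreasing D.cdf_is_right_cont D.cdf_lim_at_bot D.cdf_lim_at_top_prob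
    by (intro real_distribution_interval_measure) auto
  moreover have "cdf (interval_measure (cdf D)) = cdf D"
    using D.cdf_nondecreasing D.cdf_is_right_cont D.cdf_lim_at_bot by (intro cdf_interval_measure) auto
  ultimately have "interval_measure (cdf D) = D"
    using D.real_distribution_axioms by (intro cdf_unique) auto
  then show ?thesis
    unfolding F D_def K_def .
qed

text \<open>Averages \<open>poisson_prob_approx\<close> over the mixing law;
  \<open>s j \<le> 1\<close> keeps the exponentials bounded and hence integrable.\<close>

lemma mixed_poisson_prob_approx:
  assumes approx: "\<And>d :: nat. \<bar>(\<Sum>j\<le>n. a j * s j ^ d) - (if d = k then 1 else 0)\<bar> \<le> \<epsilon>"
    and s: "\<And>j. s j \<le> 1"
  shows "\<bar>(\<Sum>j\<le>n. a j * limit_gf (s j)) - mixed_poisson_prob (mixing_cdf \<zeta> \<alpha> \<beta>) k\<bar> \<le> \<epsilon>"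
proof -
  interpret E: prob_space "density lborel (exponential_density \<alpha>)"
    using params by (intro prob_space_exponential_density)
  define l where "l = (\<lambda>t. mixing_constant \<zeta> \<alpha> \<beta> * exp (\<zeta> * t / 2))"
  have [measurable]: "l \<in> borel_measurable borel"
    unfolding l_def by measurable
  have l: "l t \<ge> 0" for t
    using mixing_constant_pos by (simp add: l_def)
  have mp: "mixed_poisson_prob (mixing_cdf \<zeta> \<alpha> \<beta>) k = E.expectation (\<lambda>t. exp (- l t) * l t ^ k / fact k)"
    unfolding mixed_poisson_prob_def interval_measure_mixing_cdf l_def
    by (subst integral_distr) auto
  have gf: "limit_gf (s j) = E.expectation (\<lambda>t. exp (- (1 - s j) * l t))" for j
    by (simp add: limit_gf_def l_def)
  have w: "exp (- x) * x ^ k / fact k \<le> 1" if "x \<ge> 0" for x :: real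
    using that pmf_le_1[of "poisson_pmf x" k] by (cases "x = 0") (auto simp: mult_ac power_0_left)
  have int_w: "integrable (density lborel (exponential_density \<alpha>)) (\<lambda>t. exp (- l t) * l t ^ k / fact k)"
    using l w by (intro E.integrable_const_bound[of _ 1]) auto
  have int_e: "integrable (density lborel (exponential_density \<alpha>)) (\<lambda>t. exp (- (1 - s j) * l t))" for j
  proof (intro E.integrable_const_bound[of _ 1] AE_I2)
    fix t
    have "0 \<le> (1 - s j) * l t"
      using s l by simp
    then show "norm (exp (- (1 - s j) * l t)) \<le> 1"
      by (simp only: real_norm_def abs_exp_cancel exp_le_one_iff minus_mult_left[symmetric] neg_le_0_iff_le)
  qed auto
  have int_sum: "integrable (density lborel (exponential_density \<alpha>)) (\<lambda>t. \<Sum>j\<le>n. a j * exp (- (1 - s j) * l t))"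
    by (rule Bochner_Integration.integrable_sum) (rule integrable_mult_right[OF int_e])
  have eq: "(\<Sum>j\<le>n. a j * limit_gf (s j)) - mixed_poisson_prob (mixing_cdf \<zeta> \<alpha> \<beta>) k
      = E.expectation (\<lambda>t. (\<Sum>j\<le>n. a j * exp (- (1 - s j) * l t)) - exp (- l t) * l t ^ k / fact k)"
    unfolding mp gf Bochner_Integration.integral_diff[OF int_sum int_w]
    by (subst Bochner_Integration.integral_sum[OF integrable_mult_right[OF int_e]]) (simp only: integral_mult_right_zero)
  have "\<bar>(\<Sum>j\<le>n. a j * limit_gf (s j)) - mixed_poisson_prob (mixing_cdf \<zeta> \<alpha> \<beta>) k\<bar>
      \<le> E.expectation (\<lambda>t. \<bar>(\<Sum>j\<le>n. a j * exp (- (1 - s j) * l t)) - exp (- l t) * l t ^ k / fact k\<bar>)"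
    unfolding eq by (rule integral_abs_bound)
  also have "\<dots> \<le> E.expectation (\<lambda>_. \<epsilon>)"
  proof (rule integral_mono)
    show "integrable (density lborel (exponential_density \<alpha>))
        (\<lambda>t. \<bar>(\<Sum>j\<le>n. a j * exp (- (1 - s j) * l t)) - exp (- l t) * l t ^ k / fact k\<bar>)"
      by (rule integrable_abs[OF Bochner_Integration.integrable_diff[OF int_sum int_w]])
    show "\<bar>(\<Sum>j\<le>n. a j * exp (- (1 - s j) * l t)) - exp (- l t) * l t ^ k / fact k\<bar> \<le> \<epsilon>" for t
      using l approx by (rule poisson_prob_approx)
  qed (rule E.integrable_const)
  finally show ?thesis
    using E.prob_space by simp
qed

text \<open>The same approximation averaged over the vertices. It is deterministic, valid for every
  graph \<open>G\<close>.\<close>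

lemma num_degree_approx:
  assumes approx: "\<And>d :: nat. \<bar>(\<Sum>j\<le>n. a j * s j ^ d) - (if d = k then 1 else 0)\<bar> \<le> \<epsilon>" and "N > 0"
  shows "\<bar>(\<Sum>j\<le>n. a j * degree_gf N (s j) G) - real (num_degree N k G) / real N\<bar> \<le> \<epsilon>"
proof -
  let ?d = "vertex_degree N G"
  have "real (num_degree N k G) = (\<Sum>v\<in>{v \<in> {..<N}. ?d v = k}. 1)"
    by (simp add: num_degree_def)
  also have "\<dots> = (\<Sum>v<N. if ?d v = k then 1 else 0)"
    by (rule sum.inter_filter) auto
  finally have num: "real (num_degree N k G) = (\<Sum>v<N. if ?d v = k then 1 else 0)" .
  have "(\<Sum>j\<le>n. a j * degree_gf N (s j) G) = (\<Sum>j\<le>n. \<Sum>v<N. a j * s j ^ ?d v) / real N"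
    by (simp add: degree_gf_def sum_distrib_left sum_divide_distrib)
  also have "\<dots> = (\<Sum>v<N. \<Sum>j\<le>n. a j * s j ^ ?d v) / real N"
    by (subst sum.swap) simp
  finally have "\<bar>(\<Sum>j\<le>n. a j * degree_gf N (s j) G) - real (num_degree N k G) / real N\<bar>
      = \<bar>\<Sum>v<N. (\<Sum>j\<le>n. a j * s j ^ ?d v) - (if ?d v = k then 1 else 0)\<bar> / real N"
    by (simp add: num sum_subtractf diff_divide_distrib[symmetric])
  also have "\<dots> \<le> (\<Sum>v<N. \<epsilon>) / real N"
    by (intro divide_right_mono order_trans[OF sum_abs] sum_mono approx) auto
  finally show ?thesis
    using assms(2) by simp
qed

text \<open>Frequency and limit probability each lie within \<epsilon> / 3 of the same linear
  combination of generating functions, empirical and limiting. A deviation above \<epsilon>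
  therefore forces one of finitely many values of \<open>degree_gf\<close> to deviate by more than
  \<delta>, and a union bound finishes.\<close>

lemma tendsto_in_probability_num_degree:
  "tendsto_in_probability (random_graph \<zeta> \<alpha> \<beta>) (\<lambda>N G. real (num_degree N k G) / real N)
     (mixed_poisson_prob (mixing_cdf \<zeta> \<alpha> \<beta>) k)"
  unfolding tendsto_in_probability_def
proof (intro allI impI)
  fix \<epsilon> :: real assume "\<epsilon> > 0"
  define p where "p = mixed_poisson_prob (mixing_cdf \<zeta> \<alpha> \<beta>) k"
  define s where "s = (\<lambda>j. (1 / 2 :: real) ^ j)"
  have s: "0 \<le> s j" "s j \<le> 1" for j
    by (auto simp: s_def power_le_one)
  obtain a n where "\<And>d :: nat. \<bar>(\<Sum>j\<le>n. a j * ((1 / 2) ^ j) ^ d) - (if d = k then 1 else 0)\<bar> \<le> \<epsilon> / 3"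
    using indicator_nat_approx_powers[of "\<epsilon> / 3" k] \<open>\<epsilon> > 0\<close> by auto
  then have approx: "\<bar>(\<Sum>j\<le>n. a j * s j ^ d) - (if d = k then 1 else 0)\<bar> \<le> \<epsilon> / 3" for d :: nat
    by (simp add: s_def)
  \<comment> \<open>Makes the total error of the linear combination at most \<epsilon> / 3; the
    added 1 keeps the denominator positive when all coefficients vanish.\<close>
  define \<delta> where "\<delta> = \<epsilon> / 3 / (1 + (\<Sum>j\<le>n. \<bar>a j\<bar>))"
  have a: "0 \<le> (\<Sum>j\<le>n. \<bar>a j\<bar>)"
    by (intro sum_nonneg) auto
  have \<delta>: "\<delta> > 0"
    unfolding \<delta>_def using \<open>\<epsilon> > 0\<close> a by (intro divide_pos_pos add_pos_nonneg) auto
  have \<delta>_le: "(\<Sum>j\<le>n. \<bar>a j\<bar>) * \<delta> \<le> \<epsilon> / 3"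
  proof -
    have "1 + (\<Sum>j\<le>n. \<bar>a j\<bar>) > 0"
      using a by linarith
    then have "\<epsilon> / 3 * ((\<Sum>j\<le>n. \<bar>a j\<bar>) / (1 + (\<Sum>j\<le>n. \<bar>a j\<bar>))) \<le> \<epsilon> / 3 * 1"
      using \<open>\<epsilon> > 0\<close> by (intro mult_left_mono) (auto simp: divide_le_eq)
    then show ?thesis
      by (simp add: \<delta>_def mult.commute)
  qed
  have p: "\<bar>(\<Sum>j\<le>n. a j * limit_gf (s j)) - p\<bar> \<le> \<epsilon> / 3"
    unfolding p_def using approx s(2) by (rule mixed_poisson_prob_approx)
  let ?B = "\<lambda>N j. {G. \<bar>degree_gf N (s j) G - limit_gf (s j)\<bar> > \<delta>}"
  have incl: "{G. \<bar>real (num_degree N k G) / real N - p\<bar> > \<epsilon>} \<subseteq> (\<Union>j\<le>n. ?B N j)" if "N > 0" for N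
  proof
    fix G assume G: "G \<in> {G. \<bar>real (num_degree N k G) / real N - p\<bar> > \<epsilon>}"
    show "G \<in> (\<Union>j\<le>n. ?B N j)"
    proof (rule ccontr)
      assume "G \<notin> (\<Union>j\<le>n. ?B N j)"
      then have le: "\<bar>degree_gf N (s j) G - limit_gf (s j)\<bar> \<le> \<delta>" if "j \<le> n" for j
        using that by (auto simp: not_less)
      have "\<bar>(\<Sum>j\<le>n. a j * degree_gf N (s j) G) - (\<Sum>j\<le>n. a j * limit_gf (s j))\<bar>
          = \<bar>\<Sum>j\<le>n. a j * (degree_gf N (s j) G - limit_gf (s j))\<bar>"
        by (simp add: sum_subtractf right_diff_distrib)
      also have "\<dots> \<le> (\<Sum>j\<le>n. \<bar>a j\<bar> * \<delta>)"
        using le by (intro order_trans[OF sum_abs] sum_mono) (auto simp: abs_mult intro!: mult_left_mono)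
      also have "\<dots> \<le> \<epsilon> / 3"
        using \<delta>_le by (simp add: sum_distrib_right)
      finally have "\<bar>real (num_degree N k G) / real N - p\<bar> \<le> \<epsilon>"
        using num_degree_approx[OF approx that, of G] p by linarith
      then show False
        using G by simp
    qed
  qed
  have "(\<lambda>N. measure (random_graph \<zeta> \<alpha> \<beta> N) {G. \<bar>real (num_degree N k G) / real N - p\<bar> > \<epsilon>}) \<longlonglongrightarrow> 0"
  proof (rule tendsto_sandwich[of "\<lambda>_. 0"])
    have "(\<lambda>N. \<Sum>j\<le>n. measure (random_graph \<zeta> \<alpha> \<beta> N) (?B N j)) \<longlonglongrightarrow> (\<Sum>j\<le>n. 0)"
      using s \<delta> by (intro tendsto_sum tendsto_measure_degree_gf)
    then show "(\<lambda>N. \<Sum>j\<le>n. measure (random_graph \<zeta> \<alpha> \<beta> N) (?B N j)) \<longlonglongrightarrow> 0"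
      by simp
    show "\<forall>\<^sub>F N in sequentially. measure (random_graph \<zeta> \<alpha> \<beta> N) {G. \<bar>real (num_degree N k G) / real N - p\<bar> > \<epsilon>}
        \<le> (\<Sum>j\<le>n. measure (random_graph \<zeta> \<alpha> \<beta> N) (?B N j))"
      using eventually_ge_at_top[of 2]
    proof eventually_elim
      case (elim N)
      interpret RG: prob_space "random_graph \<zeta> \<alpha> \<beta> N"
        using elim params by (intro prob_space_random_graph)
      have "RG.prob {G. \<bar>real (num_degree N k G) / real N - p\<bar> > \<epsilon>} \<le> RG.prob (\<Union>j\<le>n. ?B N j)"
        using incl[of N] elim by (intro RG.finite_measure_mono) (auto simp: sets_random_graph)
      also have "\<dots> \<le> (\<Sum>j\<le>n. RG.prob (?B N j))"
        by (intro RG.finite_measure_subadditive_finite) (auto simp: sets_random_graph)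
      finally show ?case .
    qed
  qed auto
  then show "(\<lambda>N. measure (random_graph \<zeta> \<alpha> \<beta> N) {G \<in> space (random_graph \<zeta> \<alpha> \<beta> N).
      \<bar>real (num_degree N k G) / real N - mixed_poisson_prob (mixing_cdf \<zeta> \<alpha> \<beta>) k\<bar> > \<epsilon>}) \<longlonglongrightarrow> 0"
    by (simp add: p_def space_random_graph)
qed

end

theorem theorem1p2:
  fixes \<zeta> \<alpha> \<beta> :: real and k :: nat
  assumes "0 < \<zeta>" and "\<zeta> < 2" and "\<alpha> > 0"
    and "\<beta> > 1" and "0 < \<zeta> / \<alpha>" and "\<zeta> / \<alpha> < 2"
  shows "tendsto_in_probability (random_graph \<zeta> \<alpha> \<beta>)
           (\<lambda>N G. real (num_degree N k G) / real N)
           (mixed_poisson_prob (mixing_cdf \<zeta> \<alpha> \<beta>) k)"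
proof -
  interpret hyperbolic_parameters \<zeta> \<alpha> \<beta>
    by standard (use assms in \<open>auto simp: divide_less_eq\<close>)
  show ?thesis
    by (rule tendsto_in_probability_num_degree)
qed

end
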